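(* Let $D$ be a dessin d'enfant and let $D^*$ be its dual dessin. Then the quivers $\mathring{Q}_D$ and $\mathring{Q}_{D^*}^{op}$ are equal. Furthermore, if $D$ has no vertices and no faces of degree 1, then the quivers $Q_D$ and $Q_{D^*}^{op}$ are equal.
   Context: **Dessins.** A dessin d'enfant (dessin) is a pair $D=(X,f)$ where $X$ is a compact connected Riemann surface and $f\colon X\to\mathbb{C}\mathbb{P}^1$ is a holomorphic ramified covering, ramified at most over $\{0,1,\infty\}$. Equivalently, it is a finite connected bipartite graph (multiple edges allowed) cellularly embedded in a closed connected oriented surface: the black vertices are $f^{-1}(0)$, the white vertices are $f^{-1}(1)$, the half-edges are the preimages of the open interval $(0,1)$ (each joins one black and one white vertex), and the faces (components of the complement) correspond to the points of $f^{-1}(\infty)$. The half-edges are labelled by $\{1,\dots,n\}$, $n=\deg f$, and $\sigma\in S_n$ denotes the permutation recording the counter-clockwise cyclic orders of the half-edges around the black vertices (with respect to the orientation of $X$). The degree of a (black or white) vertex is the number of half-edges incident to it; the degree of a face is half the number of half-edges on its boundary (counted with multiplicity), i.e. the ramification index of $f$ at the corresponding point of $f^{-1}(\infty)$. **Dual dessin.** The dual of $D=(X,f)$ is the dessin $D^*=(X,1/f)$. Its black vertices are the face centres $f^{-1}(\infty)$ of $D$, its face centres are the black vertices of $D$, and its white vertices are the white vertices $f^{-1}(1)$ of $D$. **The quivers $\mathring{Q}_D$ and $Q_D$.** The vertices of $\mathring{Q}_D$ are the white vertices of $D$. For every cycle $(i_1\cdots i_k)$ of $\sigma$, $k\ge1$,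 let $\alpha_{i_m}$ be the white vertex incident with half-edge $i_m$; the cycle contributes $k$ arrows forming an oriented cycle $\alpha_{i_1}\to\alpha_{i_2}\to\cdots\to\alpha_{i_k}\to\alpha_{i_1}$ (the $\alpha_{i_m}$ need not be distinct; a cycle of length 1 contributes a loop, called a formal loop arrow). The quiver $Q_D$ is obtained from $\mathring{Q}_D$ by removing all formal loop arrows, i.e. the loops induced by black vertices of degree 1. $\mathring{Q}_{D^*}$ and $Q_{D^*}$ are the corresponding quivers of the dessin $D^*$. For a quiver $Q$, $Q^{op}$ is the quiver with the same vertices and all arrows reversed. Equality of quivers is understood with the vertex sets of both quivers identified with the common set $f^{-1}(1)$ of white vertices of $D$ and $D^*$ (i.e. the arrows correspond bijectively, compatibly with sources and targets in $f^{-1}(1)$). *)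

theory Defs
  imports "HOL-Complex_Analysis.Complex_Analysis" "Graph_Theory.Digraph"
begin

section \<open>Riemann surfaces and holomorphic maps\<close>

record 'a surface =
  surf_top :: "'a topology"
  charts :: "('a set \<times> ('a \<Rightarrow> complex)) set"

definition riemann_surface :: "'a surface \<Rightarrow> bool" where
  "riemann_surface X \<longleftrightarrow>
     Hausdorff_space (surf_top X) \<and>
     (\<Union>(U, \<phi>)\<in>charts X. U) = topspace (surf_top X) \<and>
     (\<forall>(U, \<phi>)\<in>charts X. openin (surf_top X) U \<and> open (\<phi> ` U) \<and>
        homeomorphic_map (subtopology (surf_top X) U) (top_of_set (\<phi> ` U)) \<phi>) \<and>
     (\<forall>(U, \<phi>)\<in>charts X. \<forall>(V, \<psi>)\<in>charts X.
        (\<psi> \<circ> inv_into U \<phi>) holomorphic_on \<phi> ` (U \<inter> V))"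

definition holomorphic_map :: "'a surface \<Rightarrow> 'b surface \<Rightarrow> ('a \<Rightarrow> 'b) \<Rightarrow> bool" where
  "holomorphic_map X Y f \<longleftrightarrow>
     continuous_map (surf_top X) (surf_top Y) f \<and>
     (\<forall>(U, \<phi>)\<in>charts X. \<forall>(V, \<psi>)\<in>charts Y.
        (\<psi> \<circ> f \<circ> inv_into U \<phi>) holomorphic_on \<phi> ` (U \<inter> f -` V))"

text \<open>
  An arbitrarily chosen chart around a point. The ramification index and the rotation
  at the black vertices, defined below by means of it, do not depend on the choice,
  because transition maps are biholomorphic.
\<close>

definition chart_at :: "'a surface \<Rightarrow> 'a \<Rightarrow> 'a set \<times> ('a \<Rightarrow> complex)" where
  "chart_at X x = (SOME c. c \<in> charts X \<and> x \<in> fst c)"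

definition ramification_index :: "'a surface \<Rightarrow> 'b surface \<Rightarrow> ('a \<Rightarrow> 'b) \<Rightarrow> 'a \<Rightarrow> nat" where
  "ramification_index X Y f x =
     (let (U, \<phi>) = chart_at X x; (V, \<psi>) = chart_at Y (f x)
      in nat (zorder (\<lambda>z. \<psi> (f (inv_into U \<phi> z)) - \<psi> (f x)) (\<phi> x)))"

text \<open>
  The complex projective line as the one-point compactification of the plane:
  \<^term>\<open>None\<close> is the point at infinity, and the two charts are
  the coordinate \<open>z\<close> off infinity and the coordinate \<open>1/z\<close> off zero.
\<close>

definition riemann_sphere :: "complex option surface" where
  "riemann_sphere =
     \<lparr> surf_top = Alexandroff_compactification euclidean,
       charts = {(- {None}, the),
                 (- {Some 0}, \<lambda>p. case p of None \<Rightarrow> 0 | Some z \<Rightarrow> 1 / z)} \<rparr>"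

definition sphere_inverse :: "complex option \<Rightarrow> complex option" where
  "sphere_inverse p =
     (case p of None \<Rightarrow> Some 0 | Some z \<Rightarrow> if z = 0 then None else Some (1 / z))"


section \<open>Dessins d'enfants\<close>

text \<open>
  On a compact connected Riemann surface the holomorphic ramified coverings of the
  projective line are the non-constant holomorphic maps to it.
  (Non-constancy also excludes the empty surface.)
\<close>

definition dessin :: "'a surface \<Rightarrow> ('a \<Rightarrow> complex option) \<Rightarrow> bool" where
  "dessin X f \<longleftrightarrow>
     riemann_surface X \<and> compact_space (surf_top X) \<and> connected_space (surf_top X) \<and>
     holomorphic_map X riemann_sphere f \<and>
     \<not> (\<exists>c. \<forall>x\<in>topspace (surf_top X). f x = c) \<and>
     (\<forall>x\<in>topspace (surf_top X). f x \<notin> {Some 0, Some 1, None} \<longrightarrow>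
        ramification_index X riemann_sphere f x = 1)"

definition dual_map :: "('a \<Rightarrow> complex option) \<Rightarrow> 'a \<Rightarrow> complex option" where
  "dual_map f = sphere_inverse \<circ> f"

definition black_vertices :: "'a surface \<Rightarrow> ('a \<Rightarrow> complex option) \<Rightarrow> 'a set" where
  "black_vertices X f = {x \<in> topspace (surf_top X). f x = Some 0}"

definition white_vertices :: "'a surface \<Rightarrow> ('a \<Rightarrow> complex option) \<Rightarrow> 'a set" where
  "white_vertices X f = {x \<in> topspace (surf_top X). f x = Some 1}"

definition face_centres :: "'a surface \<Rightarrow> ('a \<Rightarrow> complex option) \<Rightarrow> 'a set" where
  "face_centres X f = {x \<in> topspace (surf_top X). f x = None}"

text \<open>
  A half-edge is a connected component of the preimage of the open unit interval.
  The half-edges themselves serve as labels, in place of the numbers from 1 to \<open>deg f\<close>.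
\<close>

definition half_edges :: "'a surface \<Rightarrow> ('a \<Rightarrow> complex option) \<Rightarrow> 'a set set" where
  "half_edges X f =
     connected_components_of (subtopology (surf_top X)
       {x. \<exists>t::real. 0 < t \<and> t < 1 \<and> f x = Some (of_real t)})"

definition half_edges_at :: "'a surface \<Rightarrow> ('a \<Rightarrow> complex option) \<Rightarrow> 'a \<Rightarrow> 'a set set" where
  "half_edges_at X f v = {h \<in> half_edges X f. v \<in> surf_top X closure_of h}"

definition black_end :: "'a surface \<Rightarrow> ('a \<Rightarrow> complex option) \<Rightarrow> 'a set \<Rightarrow> 'a" where
  "black_end X f h = (THE v. v \<in> black_vertices X f \<and> h \<in> half_edges_at X f v)"

definition white_end :: "'a surface \<Rightarrow> ('a \<Rightarrow> complex option) \<Rightarrow> 'a set \<Rightarrow> 'a" where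
  "white_end X f h = (THE v. v \<in> white_vertices X f \<and> h \<in> half_edges_at X f v)"

definition vertex_degree :: "'a surface \<Rightarrow> ('a \<Rightarrow> complex option) \<Rightarrow> 'a \<Rightarrow> nat" where
  "vertex_degree X f v = card (half_edges_at X f v)"

definition face_degree :: "'a surface \<Rightarrow> ('a \<Rightarrow> complex option) \<Rightarrow> 'a \<Rightarrow> nat" where
  "face_degree X f c = ramification_index X riemann_sphere f c"


section \<open>The rotation at the black vertices\<close>

text \<open>
  The unit tangent vector at the point \<open>v\<close> of an arc \<open>h\<close> that ends in \<open>v\<close>,
  read in the chart around \<open>v\<close>. Another chart rotates all these vectors by the same angle.
\<close>

definition direction :: "'a surface \<Rightarrow> 'a \<Rightarrow> 'a set \<Rightarrow> complex" where
  "direction X v h =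
     Lim (atin_within (surf_top X) v h) (\<lambda>x. sgn (snd (chart_at X v) x - snd (chart_at X v) v))"

text \<open>
  The counter-clockwise angle from \<open>u\<close> to \<open>w\<close>, taken in the interval from 0 (exclusive)
  to \<open>2\<pi>\<close> (inclusive): coming back to the start takes a full turn. Hence the half-edge at
  the least such angle from \<open>h\<close> is the next one counter-clockwise, and it is \<open>h\<close> itself
  precisely when no other half-edge is incident to the vertex.
\<close>

definition ccw_angle :: "complex \<Rightarrow> complex \<Rightarrow> real" where
  "ccw_angle u w = (if Arg2pi (w / u) = 0 then 2 * pi else Arg2pi (w / u))"

definition rotation :: "'a surface \<Rightarrow> ('a \<Rightarrow> complex option) \<Rightarrow> 'a set \<Rightarrow> 'a set" where
  "rotation X f h =
     (let v = black_end X f h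
      in arg_min_on (\<lambda>h'. ccw_angle (direction X v h) (direction X v h')) (half_edges_at X f v))"


section \<open>The quivers of a dessin\<close>

text \<open>
  A quiver is a directed multigraph. A cycle \<open>(i\<^sub>1 \<dots> i\<^sub>k)\<close> of the rotation contributes
  one arrow for each of its half-edges, from the white end of the half-edge to the white end
  of its successor, so the half-edges index the arrows; the formal loop arrows are those
  indexed by the fixed points of the rotation.
\<close>

definition full_quiver ::
    "'a surface \<Rightarrow> ('a \<Rightarrow> complex option) \<Rightarrow> ('a, 'a set) pre_digraph" where
  "full_quiver X f =
     \<lparr> verts = white_vertices X f, arcs = half_edges X f,
       tail = white_end X f, head = (\<lambda>h. white_end X f (rotation X f h)) \<rparr>"

definition formal_loops :: "'a surface \<Rightarrow> ('a \<Rightarrow> complex option) \<Rightarrow> 'a set set" where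
  "formal_loops X f = {h \<in> half_edges X f. rotation X f h = h}"

definition dessin_quiver ::
    "'a surface \<Rightarrow> ('a \<Rightarrow> complex option) \<Rightarrow> ('a, 'a set) pre_digraph" where
  "dessin_quiver X f =
     (full_quiver X f) \<lparr> arcs := arcs (full_quiver X f) - formal_loops X f \<rparr>"

definition op_quiver :: "('v, 'e) pre_digraph \<Rightarrow> ('v, 'e) pre_digraph" where
  "op_quiver Q = \<lparr> verts = verts Q, arcs = arcs Q, tail = head Q, head = tail Q \<rparr>"

text \<open>
  Equality of quivers on the same vertex set: unlike for isomorphism of digraphs,
  the vertices are fixed and only the arrows are matched by a bijection.
\<close>

definition quiver_eq :: "('v, 'e) pre_digraph \<Rightarrow> ('v, 'f) pre_digraph \<Rightarrow> bool" where
  "quiver_eq P Q \<longleftrightarrow>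
     verts P = verts Q \<and>
     (\<exists>\<beta>. bij_betw \<beta> (arcs P) (arcs Q) \<and>
        (\<forall>a\<in>arcs P. tail Q (\<beta> a) = tail P a \<and> head Q (\<beta> a) = head P a))"

end

theory Submission
  imports Defs
begin

text \<open>
  Colour the triangles of a dessin: the components of the preimages of the upper and of the lower half plane.
  Each of them is mapped homeomorphically onto its half plane and has three sides, over the intervals from 0 to 1,
  from 1 to infinity and from infinity to 0. The sides of the first kind are the half-edges of \<open>f\<close>, those of the
  second kind are the half-edges of \<open>1 / f\<close>, and those of the third kind serve both dessins alike. Turning
  counter-clockwise around a black vertex, one leaves a half-edge \<open>h\<close> into its upper triangle, crosses a side \<open>e\<close> of
  the third kind and reaches the next half-edge \<open>h'\<close> through its lower triangle. Let \<open>b'\<close> and \<open>b\<close> be the sides of the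
  second kind of these two triangles. Since inversion exchanges the half planes, the rotation of the dual around the
  face centre at the other end of \<open>e\<close> crosses \<open>e\<close> in the opposite sense and takes \<open>b\<close> to \<open>b'\<close>. A triangle
  has only one white vertex, so \<open>h\<close> and \<open>b'\<close> end in the same white vertex, and so do \<open>h'\<close> and \<open>b\<close>. Therefore
  the assignment of \<open>b\<close> to \<open>h\<close> carries the arrow of \<open>h\<close> to the arrow of \<open>b\<close> reversed; see \<open>crosses\<close> and
  \<open>crosses_white_ends\<close>.

  Two triangles with a common side are represented by a section of \<open>f\<close> over the plane with two rays, or one
  ray, of the real axis removed. Such sections exist through every point since these domains are simply connected and
  \<open>f\<close> is a covering away from 0, 1 and infinity (\<open>section_exists\<close>, \<open>lifts_over_rectangle\<close>); the covering
  property and the behaviour of sections at 0 and 1 come from the local form \<open>a + w ^ k\<close> of \<open>f\<close> and from compactness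
  (\<open>power_chart_exists\<close>, \<open>power_charts_cover_fibre\<close>, \<open>section_limit\<close>). The only place where the analytic definition
  of the rotation is unfolded is \<open>rotation_ray\<close>: in the coordinate \<open>w\<close> the half-edges at a black vertex are the rays
  at the multiples of \<open>2 * pi / k\<close>. Its consequence \<open>rotation_via_gap_section\<close> is applied once to \<open>f\<close> and once
  to \<open>1 / f\<close>.

  Formal loops are the fixed points of the rotation. They occur at the black vertices with \<open>k = 1\<close> only, that is, for
  \<open>f\<close> at the black vertices of degree 1 and for the dual at the faces of degree 1. Without these both quivers equal their full
  versions.
\<close>

section \<open>Local form of holomorphic functions\<close>

text \<open>
  Near a zero of order \<open>k\<close>, \<open>F z - F z0 = (z - z0) ^ k * g0 z\<close> with \<open>g0\<close> zero-free on a disc. Hence \<open>g0\<close>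
  has a logarithm there, therefore a \<open>k\<close>-th root \<open>g\<close>, and \<open>(z - z0) * g z\<close> is a local coordinate because
  its derivative at \<open>z0\<close> is \<open>g z0 \<noteq> 0\<close>. The factor \<open>g\<close> is kept visible in the conclusion:
  it relates directions in this coordinate to directions in the original one.
\<close>

lemma holomorphic_local_power_form:
  fixes F :: "complex \<Rightarrow> complex"
  assumes hol: "F holomorphic_on S" and S: "open S" "z0 \<in> S"
    and nonconst: "\<And>T. open T \<Longrightarrow> z0 \<in> T \<Longrightarrow> T \<subseteq> S \<Longrightarrow> \<exists>z\<in>T. F z \<noteq> F z0"
    and R: "0 < R"
  obtains k r T g w' where "0 < k" "0 < r" "r \<le> R" "open T" "z0 \<in> T" "T \<subseteq> S"
    "homeomorphism T (ball 0 r) (\<lambda>z. (z - z0) * g z) w'"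
    "\<And>z. z \<in> T \<Longrightarrow> F z = F z0 + ((z - z0) * g z) ^ k"
    "isCont g z0" "\<And>z. z \<in> T \<Longrightarrow> g z \<noteq> 0"
    "zorder (\<lambda>z. F z - F z0) z0 = int k"
proof -
  obtain e where e: "e > 0" "ball z0 e \<subseteq> S" using S openE by blast
  have "\<exists>z\<in>ball z0 e. F z \<noteq> F z0"
    using nonconst[of "ball z0 e"] e by auto
  then have nc: "\<not> (\<lambda>z. F z - F z0) constant_on ball z0 e"
    using e unfolding constant_on_def by (metis centre_in_ball right_minus_eq)
  have hF: "(\<lambda>z. F z - F z0) holomorphic_on ball z0 e"
    using hol e by (intro holomorphic_intros) (auto intro: holomorphic_on_subset)
  obtain g0 r0 k where g0: "0 < k" "0 < r0" "ball z0 r0 \<subseteq> ball z0 e"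
      "g0 holomorphic_on ball z0 r0"
      "\<And>w. w \<in> ball z0 r0 \<Longrightarrow> F w - F z0 = (w - z0) ^ k * g0 w"
      "\<And>w. w \<in> ball z0 r0 \<Longrightarrow> g0 w \<noteq> 0"
    by (rule holomorphic_factor_zero_nonconstant[OF hF open_ball connected_ball _ _ nc]) (use e in auto)
  obtain l where l: "l holomorphic_on ball z0 r0" "\<And>z. z \<in> ball z0 r0 \<Longrightarrow> g0 z = exp (l z)"
    using holomorphic_logarithm_exists[of "ball z0 r0" g0 z0] g0 by (metis centre_in_ball convex_ball open_ball[of z0 r0])
  define g where "g = (\<lambda>z. exp (l z / of_nat k))"
  define w where "w = (\<lambda>z. (z - z0) * g z)"
  have gk: "g z ^ k = g0 z" if "z \<in> ball z0 r0" for z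
    using l(2)[OF that] g0(1) by (simp add: g_def flip: exp_of_nat_mult)
  have holg: "g holomorphic_on ball z0 r0"
    unfolding g_def using l g0(1) by (intro holomorphic_intros) auto
  have holw: "w holomorphic_on ball z0 r0"
    unfolding w_def using holg by (intro holomorphic_intros)
  have z0: "z0 \<in> ball z0 r0" using g0 by simp
  have contg: "isCont g z0"
    using holomorphic_on_imp_continuous_on[OF holg] z0 by (simp add: continuous_on_eq_continuous_at)
  have "(g has_field_derivative deriv g z0) (at z0)"
    using holg z0 by (meson holomorphic_derivI open_ball)
  then have "(w has_field_derivative ((1 - 0) * g z0 + deriv g z0 * (z0 - z0))) (at z0)"
    unfolding w_def by (intro DERIV_mult DERIV_diff DERIV_ident DERIV_const)
  then have "deriv w z0 \<noteq> 0"
    by (auto simp: g_def dest!: DERIV_imp_deriv)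
  then obtain r1 where r1: "r1 > 0" "ball z0 r1 \<subseteq> ball z0 r0" "inj_on w (ball z0 r1)"
    using has_complex_derivative_locally_injective[OF holw z0] by auto
  have holw1: "w holomorphic_on ball z0 r1"
    using holw r1 holomorphic_on_subset by blast
  obtain v where v: "homeomorphism (ball z0 r1) (w ` ball z0 r1) w v"
    using invariance_of_domain_homeomorphism[of "ball z0 r1" w] r1 holw1 holomorphic_on_imp_continuous_on
    by auto
  have "open (w ` ball z0 r1)" using open_mapping_thm3[OF holw1] r1 by simp
  moreover have "0 \<in> w ` ball z0 r1" using r1 by (auto simp: w_def image_iff intro!: bexI[of _ z0])
  ultimately obtain r2 where r2: "r2 > 0" "ball 0 r2 \<subseteq> w ` ball z0 r1"
    by (meson openE)
  define r where "r = min r2 R"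
  have r: "0 < r" "r \<le> R" "ball 0 r \<subseteq> w ` ball z0 r1" using r2 R by (auto simp: r_def)
  define T where "T = ball z0 r1 \<inter> w -` ball 0 r"
  have opT: "open T" unfolding T_def
    using holw1 by (intro continuous_open_preimage holomorphic_on_imp_continuous_on) auto
  have z0T: "z0 \<in> T" using r r1 by (simp add: T_def w_def)
  have Tsub: "T \<subseteq> ball z0 r1" by (auto simp: T_def)
  have "homeomorphism T (ball 0 r) w v"
    using v Tsub by (rule homeomorphism_of_subsets) (use r in \<open>auto simp: T_def\<close>)
  then have hom: "homeomorphism T (ball 0 r) (\<lambda>z. (z - z0) * g z) v" by (simp add: w_def)
  have zo: "zorder (\<lambda>z. F z - F z0) z0 = int k"
    by (rule zorder_eqI[OF _ z0 g0(4)]) (use g0 z0 in \<open>auto simp: mult.commute\<close>)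
  have pow: "F z = F z0 + ((z - z0) * g z) ^ k" if "z \<in> T" for z
  proof -
    have "z \<in> ball z0 r0" using that Tsub r1 by auto
    then have "F z - F z0 = ((z - z0) * g z) ^ k" using g0(5) gk by (simp add: power_mult_distrib)
    then show ?thesis by (simp add: algebra_simps)
  qed
  have "T \<subseteq> S" using Tsub r1 g0(3) e(2) by blast
  then show ?thesis
    by (rule that[OF g0(1) r(1,2) opT z0T _ hom pow contg _ zo]) (simp_all add: g_def)
qed

section \<open>Lifting and sections over simply connected domains\<close>

text \<open>
  The set on which two lifts of the same map agree is closed because the space is Hausdorff, and open
  because \<open>p\<close> is locally injective.
\<close>

lemma lifts_agree:
  assumes H: "Hausdorff_space X" and conn: "connected_space Z"
    and u: "continuous_map Z X u" and v: "continuous_map Z X v"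
    and eq: "\<And>z. z \<in> topspace Z \<Longrightarrow> p (u z) = p (v z)"
    and inj: "\<And>z. z \<in> topspace Z \<Longrightarrow> \<exists>N. openin X N \<and> u z \<in> N \<and> inj_on p N"
    and z0: "z0 \<in> topspace Z" "u z0 = v z0" and z: "z \<in> topspace Z"
  shows "u z = v z"
proof -
  define E where "E = {z \<in> topspace Z. u z = v z}"
  have "closedin Z E"
    unfolding E_def using H u v by (rule closedin_continuous_maps_eq)
  moreover have "openin Z E"
  proof (subst openin_subopen, intro ballI)
    fix y assume y: "y \<in> E"
    then obtain N where N: "openin X N" "u y \<in> N" "inj_on p N"
      using inj[of y] by (auto simp: E_def)
    let ?T = "{z \<in> topspace Z. u z \<in> N} \<inter> {z \<in> topspace Z. v z \<in> N}"
    have "openin Z ?T"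
      using N u v by (intro openin_Int openin_continuous_map_preimage)
    moreover have "y \<in> ?T" using y N by (auto simp: E_def)
    moreover have "?T \<subseteq> E" using eq N(3) by (auto simp: E_def inj_on_def)
    ultimately show "\<exists>T. openin Z T \<and> y \<in> T \<and> T \<subseteq> E" by blast
  qed
  moreover have "E \<noteq> {}" using z0 by (auto simp: E_def)
  ultimately have "E = topspace Z"
    using conn by (auto simp: connected_space_clopen_in)
  then show ?thesis using z by (auto simp: E_def)
qed

definition section_on :: "'a topology \<Rightarrow> ('a \<Rightarrow> complex option) \<Rightarrow> complex set \<Rightarrow> (complex \<Rightarrow> 'a) \<Rightarrow> bool" where
  "section_on X f W s \<longleftrightarrow> continuous_map (top_of_set W) X s \<and> (\<forall>z\<in>W. f (s z) = Some z)"

definition lift_on :: "'a topology \<Rightarrow> ('a \<Rightarrow> complex option) \<Rightarrow> (complex \<Rightarrow> complex) \<Rightarrow> complex set \<Rightarrow> (complex \<Rightarrow> 'a) \<Rightarrow> bool" where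
  "lift_on X f q R l \<longleftrightarrow> continuous_map (top_of_set R) X l \<and> (\<forall>z\<in>R. f (l z) = Some (q z))"

text \<open>
  Lifting with an arbitrary initial point over an arbitrary base point. This symmetric form is what makes
  the property pass from two pieces of a region to their union.
\<close>

definition lifts_over :: "'a topology \<Rightarrow> ('a \<Rightarrow> complex option) \<Rightarrow> (complex \<Rightarrow> complex) \<Rightarrow> complex set \<Rightarrow> bool" where
  "lifts_over X f q R \<longleftrightarrow>
     (\<forall>z\<in>R. \<forall>x\<in>topspace X. f x = Some (q z) \<longrightarrow> (\<exists>l. lift_on X f q R l \<and> l z = x))"

lemma lift_on_subset: "lift_on X f q R l \<Longrightarrow> T \<subseteq> R \<Longrightarrow> lift_on X f q T l"
  unfolding lift_on_def by (meson continuous_map_from_subtopology_mono subsetD)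

lemma lift_on_topspace: "lift_on X f q R l \<Longrightarrow> z \<in> R \<Longrightarrow> l z \<in> topspace X"
  unfolding lift_on_def by (auto simp: continuous_map_def Pi_iff)

text \<open>
  The part of the definition of a covering over \<open>B\<close> that path lifting uses, stated for a space that is given
  by an abstract topology: sections over small discs through every point. The map \<open>f\<close> may take values outside
  \<open>B\<close>, so that a branched covering can be treated without passing to a subspace.
\<close>

locale evenly_covering =
  fixes X :: "'a topology" and f :: "'a \<Rightarrow> complex option" and B :: "complex set"
  assumes Hausdorff: "Hausdorff_space X"
    and locally_inj: "\<And>x. x \<in> topspace X \<Longrightarrow> f x \<in> Some ` B \<Longrightarrow> \<exists>N. openin X N \<and> x \<in> N \<and> inj_on f N"
    and disc_sections: "\<And>a. a \<in> B \<Longrightarrow> \<exists>\<delta>>0. \<forall>x\<in>topspace X. f x \<in> Some ` ball a \<delta> \<longrightarrow>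
        (\<exists>s. section_on X f (ball a \<delta>) s \<and> s (the (f x)) = x)"
begin

lemma lift_unique:
  assumes "lift_on X f q R l" "lift_on X f q R l'" "q ` R \<subseteq> B" "connected R"
    "z0 \<in> R" "l z0 = l' z0" "z \<in> R"
  shows "l z = l' z"
proof (rule lifts_agree[OF Hausdorff, of "top_of_set R" l l' f z0])
  show "connected_space (top_of_set R)" using assms(4)
    by (metis connectedin_def connectedin_iff_connected)
  fix z assume z: "z \<in> topspace (top_of_set R)"
  then show "f (l z) = f (l' z)" using assms(1,2) by (simp add: lift_on_def)
  show "\<exists>N. openin X N \<and> l z \<in> N \<and> inj_on f N"
    using z assms(1,3) lift_on_topspace[OF assms(1)] by (intro locally_inj) (auto simp: lift_on_def)
qed (use assms in \<open>auto simp: lift_on_def\<close>)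

lemma section_unique:
  assumes "section_on X f W s" "section_on X f W s'" "W \<subseteq> B" "connected W"
    "z0 \<in> W" "s z0 = s' z0" "z \<in> W"
  shows "s z = s' z"
  using lift_unique[of "\<lambda>z. z" W s s' z0 z] assms by (simp add: lift_on_def section_on_def)

text \<open>
  Start on the piece that contains the given point, carry the lift to a point \<open>e\<close> of the common edge, and
  continue on the other piece. The two lifts agree on the whole edge since it is connected.
\<close>

lemma lifts_over_glue:
  fixes pr :: "complex \<Rightarrow> real"
  assumes pr: "continuous_on R pr" and q: "q ` R \<subseteq> B"
    and R1: "lifts_over X f q {z\<in>R. pr z \<le> m}" and R2: "lifts_over X f q {z\<in>R. m \<le> pr z}"
    and conn: "connected {z\<in>R. pr z = m}" and ne: "e \<in> R" "pr e = m"
  shows "lifts_over X f q R"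
  unfolding lifts_over_def
proof (intro ballI impI)
  let ?R1 = "{z\<in>R. pr z \<le> m}" and ?R2 = "{z\<in>R. m \<le> pr z}" and ?E = "{z\<in>R. pr z = m}"
  have glue: "\<exists>l. lift_on X f q R l \<and> (\<forall>z\<in>?R1. l z = l1 z) \<and> (\<forall>z\<in>?R2. l z = l2 z)"
    if l1: "lift_on X f q ?R1 l1" and l2: "lift_on X f q ?R2 l2" and e: "l1 e = l2 e" for l1 l2
  proof -
    have eq: "l1 z = l2 z" if "z \<in> R" "pr z = m" for z
    proof (rule lift_unique[of q ?E l1 l2 e z])
      show "lift_on X f q ?E l1" "lift_on X f q ?E l2"
        by (rule lift_on_subset[OF l1] lift_on_subset[OF l2]; blast)+
    qed (use that conn ne q e in auto)
    have "continuous_map (top_of_set R) X (\<lambda>x. if pr x \<le> m then l1 x else l2 x)"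
    proof (rule continuous_map_cases_le)
      show "continuous_map (top_of_set R) euclideanreal pr" using pr by simp
      have "R \<inter> ?R1 = ?R1" "R \<inter> ?R2 = ?R2" by blast+
      then show "continuous_map (subtopology (top_of_set R) {x \<in> topspace (top_of_set R). pr x \<le> m}) X l1"
          "continuous_map (subtopology (top_of_set R) {x \<in> topspace (top_of_set R). m \<le> pr x}) X l2"
        using l1 l2 by (simp_all add: lift_on_def subtopology_subtopology)
    qed (use eq in auto)
    then show ?thesis
      using l1 l2 eq by (intro exI[of _ "\<lambda>x. if pr x \<le> m then l1 x else l2 x"]) (simp add: lift_on_def)
  qed
  fix z x assume z: "z \<in> R" and x: "x \<in> topspace X" "f x = Some (q z)"
  show "\<exists>l. lift_on X f q R l \<and> l z = x"
  proof (cases "pr z \<le> m")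
    case True
    then obtain l1 where l1: "lift_on X f q ?R1 l1" "l1 z = x"
      using R1 z x unfolding lifts_over_def by blast
    then have "l1 e \<in> topspace X" "f (l1 e) = Some (q e)"
      using ne lift_on_topspace[OF l1(1)] by (auto simp: lift_on_def)
    then obtain l2 where "lift_on X f q ?R2 l2" "l2 e = l1 e"
      using R2 ne unfolding lifts_over_def by force
    then show ?thesis using glue[OF l1(1), of l2] l1 True z by auto
  next
    case False
    then obtain l2 where l2: "lift_on X f q ?R2 l2" "l2 z = x"
      using R2 z x unfolding lifts_over_def by force
    then have "l2 e \<in> topspace X" "f (l2 e) = Some (q e)"
      using ne lift_on_topspace[OF l2(1)] by (auto simp: lift_on_def)
    then obtain l1 where "lift_on X f q ?R1 l1" "l1 e = l2 e"
      using R1 ne unfolding lifts_over_def by force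
    then show ?thesis using glue[OF _ l2(1), of l1] l2 False z by auto
  qed
qed

lemma lifts_over_small:
  assumes q: "continuous_on UNIV q" "range q \<subseteq> B"
  obtains e where "e > 0" "\<And>R. R \<subseteq> ball z e \<Longrightarrow> lifts_over X f q R"
proof -
  have "q z \<in> B" using q(2) by auto
  then obtain \<delta> where \<delta>: "\<delta> > 0" "\<forall>x\<in>topspace X. f x \<in> Some ` ball (q z) \<delta> \<longrightarrow>
        (\<exists>s. section_on X f (ball (q z) \<delta>) s \<and> s (the (f x)) = x)"
    by (meson disc_sections)
  have "isCont q z" using q(1) by (simp add: continuous_on_eq_continuous_at)
  then obtain e where e: "e > 0" "\<And>w. dist w z < e \<Longrightarrow> dist (q w) (q z) < \<delta>"
    using \<delta>(1) unfolding continuous_at_eps_delta by blast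
  have "lifts_over X f q R" if R: "R \<subseteq> ball z e" for R
    unfolding lifts_over_def
  proof (intro ballI impI)
    have qR: "q w \<in> ball (q z) \<delta>" if "w \<in> R" for w
      using R that e(2)[of w] by (auto simp: dist_commute)
    fix w x assume w: "w \<in> R" "x \<in> topspace X" "f x = Some (q w)"
    then obtain s where s: "section_on X f (ball (q z) \<delta>) s" "s (q w) = x"
      using \<delta>(2) qR by force
    have "continuous_map (top_of_set R) (top_of_set (ball (q z) \<delta>)) q"
      using qR continuous_on_subset[OF q(1), of R] by auto
    then have "continuous_map (top_of_set R) X (s \<circ> q)"
      using s(1) continuous_map_compose unfolding section_on_def by blast
    then have "lift_on X f q R (s \<circ> q)"
      using s(1) qR by (auto simp: lift_on_def section_on_def)
    then show "\<exists>l. lift_on X f q R l \<and> l w = x" using s(2) by (intro exI[of _ "s \<circ> q"]) simp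
  qed
  then show ?thesis using that e(1) by blast
qed

text \<open>
  Two bisections. For a fixed abscissa, bisecting the height shows that some thin vertical strip around it
  admits lifts; bisecting the width then joins strips. Doing the height first for a strip of unspecified
  width avoids any uniform choice of mesh.
\<close>

lemma lifts_over_rectangle:
  assumes q: "continuous_on UNIV q" "range q \<subseteq> B" and "a \<le> b" "c \<le> d"
  shows "lifts_over X f q {z. a \<le> Re z \<and> Re z \<le> b \<and> c \<le> Im z \<and> Im z \<le> d}"
proof -
  define P where "P a b c d = lifts_over X f q {z. a \<le> Re z \<and> Re z \<le> b \<and> c \<le> Im z \<and> Im z \<le> d}" for a b c d
  have conn: "connected {z. a \<le> Re z \<and> Re z \<le> b \<and> c \<le> Im z \<and> Im z \<le> d}" for a b c d
  proof -
    have "{z. a \<le> Re z \<and> Re z \<le> b \<and> c \<le> Im z \<and> Im z \<le> d} = cbox (Complex a c) (Complex b d)"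
      by (auto simp: in_cbox_complex_iff)
    then show ?thesis by (simp add: convex_connected)
  qed
  have vertical: "P a b c e" if P: "P a b c d" "P a b d e" and le: "c \<le> d" "d \<le> e" "a \<le> b" for a b c d e
    unfolding P_def
  proof (rule lifts_over_glue[where pr = Im and m = d and e = "Complex a d"])
    let ?R = "{z. a \<le> Re z \<and> Re z \<le> b \<and> c \<le> Im z \<and> Im z \<le> e}"
    have "{z \<in> ?R. Im z \<le> d} = {z. a \<le> Re z \<and> Re z \<le> b \<and> c \<le> Im z \<and> Im z \<le> d}"
      "{z \<in> ?R. d \<le> Im z} = {z. a \<le> Re z \<and> Re z \<le> b \<and> d \<le> Im z \<and> Im z \<le> e}"
      "{z \<in> ?R. Im z = d} = {z. a \<le> Re z \<and> Re z \<le> b \<and> d \<le> Im z \<and> Im z \<le> d}"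
      using le by auto
    then show "lifts_over X f q {z \<in> ?R. Im z \<le> d}" "lifts_over X f q {z \<in> ?R. d \<le> Im z}"
        "connected {z \<in> ?R. Im z = d}"
      using P conn by (simp_all add: P_def)
  qed (use le q in \<open>auto intro!: continuous_intros\<close>)
  have horizontal: "P a e c d" if P: "P a b c d" "P b e c d" and le: "a \<le> b" "b \<le> e" "c \<le> d" for a b c d e
    unfolding P_def
  proof (rule lifts_over_glue[where pr = Re and m = b and e = "Complex b c"])
    let ?R = "{z. a \<le> Re z \<and> Re z \<le> e \<and> c \<le> Im z \<and> Im z \<le> d}"
    have "{z \<in> ?R. Re z \<le> b} = {z. a \<le> Re z \<and> Re z \<le> b \<and> c \<le> Im z \<and> Im z \<le> d}"
      "{z \<in> ?R. b \<le> Re z} = {z. b \<le> Re z \<and> Re z \<le> e \<and> c \<le> Im z \<and> Im z \<le> d}"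
      "{z \<in> ?R. Re z = b} = {z. b \<le> Re z \<and> Re z \<le> b \<and> c \<le> Im z \<and> Im z \<le> d}"
      using le by auto
    then show "lifts_over X f q {z \<in> ?R. Re z \<le> b}" "lifts_over X f q {z \<in> ?R. b \<le> Re z}"
        "connected {z \<in> ?R. Re z = b}"
      using P conn by (simp_all add: P_def)
  qed (use le q in \<open>auto intro!: continuous_intros\<close>)
  \<comment> \<open>The width of the strip may shrink as pieces are stacked; only its positivity is carried along.\<close>
  have strip: "\<exists>\<delta>>0. \<forall>a b. a \<le> x \<and> x \<le> b \<and> b - a < \<delta> \<longrightarrow> P a b c d" for x
    using \<open>c \<le> d\<close>
  proof (induction rule: Bolzano)
    case (trans c d e)
    from trans(1) obtain \<delta> where \<delta>: "\<delta> > 0" "\<forall>a b. a \<le> x \<and> x \<le> b \<and> b - a < \<delta> \<longrightarrow> P a b c d" by auto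
    from trans(2) obtain \<delta>' where \<delta>': "\<delta>' > 0" "\<forall>a b. a \<le> x \<and> x \<le> b \<and> b - a < \<delta>' \<longrightarrow> P a b d e" by auto
    have "P a b c e" if "a \<le> x" "x \<le> b" "b - a < min \<delta> \<delta>'" for a b
      by (rule vertical[of a b c d e]) (use \<delta> \<delta>' that trans(3,4) in auto)
    then show ?case
      using \<delta>(1) \<delta>'(1) by (intro exI[of _ "min \<delta> \<delta>'"]) auto
  next
    case (local y)
    obtain e where e: "e > 0" "\<And>R. R \<subseteq> ball (Complex x y) e \<Longrightarrow> lifts_over X f q R"
      using lifts_over_small[OF q] by blast
    have "P a b c d" if "a \<le> x" "x \<le> b" "b - a < e / 2" "c \<le> y" "y \<le> d" "d - c < e / 2" for a b c d
      unfolding P_def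
    proof (rule e(2), clarify)
      fix z assume "a \<le> Re z" "Re z \<le> b" "c \<le> Im z" "Im z \<le> d"
      then have "\<bar>Re z - x\<bar> < e / 2" "\<bar>Im z - y\<bar> < e / 2" using that by linarith+
      then have "dist z (Complex x y) < e"
        using cmod_le[of "z - Complex x y"] by (simp add: dist_norm)
      then show "z \<in> ball (Complex x y) e" by (simp add: dist_commute)
    qed
    then show ?case
      using e(1) by (intro exI[of _ "e / 2"] conjI allI impI) auto
  qed
  show ?thesis unfolding P_def[symmetric]
    using \<open>a \<le> b\<close>
  proof (induction rule: Bolzano)
    case (trans a b e)
    then show ?case using horizontal \<open>c \<le> d\<close> by blast
  next
    case (local x)
    then show ?case using strip[of x] by blast
  qed
qed

text \<open>
  The lifts over growing squares extend each other by uniqueness, so they define a lift on the plane.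
\<close>

lemma lift_plane:
  assumes q: "continuous_on UNIV q" "range q \<subseteq> B" and x: "x \<in> topspace X" "f x = Some (q \<zeta>)"
  obtains l where "lift_on X f q UNIV l" "l \<zeta> = x"
proof -
  define R where "R r = {z. -r \<le> Re z \<and> Re z \<le> r \<and> -r \<le> Im z \<and> Im z \<le> r}" for r
  define U where "U r = {z. -r < Re z \<and> Re z < r \<and> -r < Im z \<and> Im z < r}" for r
  define I where "I = {norm \<zeta>..}"
  have conn: "connected (R r)" for r
  proof -
    have "R r = cbox (Complex (-r) (-r)) (Complex r r)"
      by (auto simp: in_cbox_complex_iff R_def)
    then show ?thesis by (simp add: convex_connected)
  qed
  have openU: "open (U r)" for r
  proof -
    have "U r = box (Complex (-r) (-r)) (Complex r r)"
      by (auto simp: in_box_complex_iff U_def)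
    then show ?thesis by (simp add: open_box)
  qed
  have \<zeta>: "\<zeta> \<in> R r" if "r \<in> I" for r
    using that abs_Re_le_cmod[of \<zeta>] abs_Im_le_cmod[of \<zeta>] by (auto simp: R_def I_def)
  have "\<exists>l. lift_on X f q (R r) l \<and> l \<zeta> = x" if "r \<in> I" for r
  proof -
    have "lifts_over X f q (R r)"
      unfolding R_def using that norm_ge_zero[of \<zeta>]
      by (intro lifts_over_rectangle[OF q]) (auto simp: I_def simp del: norm_ge_zero)
    then show ?thesis using x \<zeta>[OF that] unfolding lifts_over_def by blast
  qed
  then obtain l where l: "lift_on X f q (R r) (l r)" "l r \<zeta> = x" if "r \<in> I" for r
    by metis
  have UR: "U r \<subseteq> R r" for r by (auto simp: U_def R_def)
  have mono: "R r \<subseteq> R r'" if "r \<le> r'" for r r' using that by (auto simp: R_def)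
  have agree: "l r z = l r' z" if "r \<le> r'" "r \<in> I" "r' \<in> I" "z \<in> R r" for r r' z
    using lift_unique[OF l(1)[OF \<open>r \<in> I\<close>] lift_on_subset[OF l(1)[OF \<open>r' \<in> I\<close>] mono[OF \<open>r \<le> r'\<close>]] _ conn \<zeta>[OF \<open>r \<in> I\<close>]]
      q that l(2) by (metis image_subset_iff rangeI subsetD)
  \<comment> \<open>The half side of a square that contains both the base point and \<open>z\<close> in its interior.\<close>
  define r where "r z = norm z + norm \<zeta> + 1" for z :: complex
  have r: "r z \<in> I" "z \<in> U (r z)" for z
    using abs_Re_le_cmod[of z] abs_Im_le_cmod[of z] norm_ge_zero[of \<zeta>] norm_ge_zero[of z]
    unfolding U_def I_def r_def atLeast_iff mem_Collect_eq by linarith+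
  have agree': "l a z = l b z" if ab: "a \<in> I" "b \<in> I" and z: "z \<in> U a" "z \<in> U b" for a b z
  proof (cases "a \<le> b")
    case True
    then show ?thesis by (rule agree[OF _ ab subsetD[OF UR z(1)]])
  next
    case False
    then have "b \<le> a" by simp
    then show ?thesis by (rule agree[OF _ ab(2,1) subsetD[OF UR z(2)], symmetric])
  qed
  have "continuous_map euclidean X (\<lambda>z. l (r z) z)"
  proof (rule pasting_lemma[where I = I and T = U and f = l])
    show "continuous_map (top_of_set (U r)) X (l r)" if "r \<in> I" for r
      using lift_on_subset[OF l(1)[OF that] UR] by (simp add: lift_on_def)
    show "\<exists>j. j \<in> I \<and> z \<in> U j \<and> l (r z) z = l j z" for z using r by blast
  next
    show "openin euclidean (U r)" for r using openU by simp
  next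
    show "l r z = l r' z" if "r \<in> I" "r' \<in> I" "z \<in> topspace euclidean \<inter> U r \<inter> U r'" for r r' z
      using that by (intro agree') auto
  qed
  moreover have "f (l (r z) z) = Some (q z)" for z
    using l(1)[OF r(1)[of z]] subsetD[OF UR r(2)[of z]] unfolding lift_on_def by blast
  moreover have "l (r \<zeta>) \<zeta> = x" using r(1) by (rule l(2))
  ultimately show ?thesis using that[of "\<lambda>z. l (r z) z"] by (simp add: lift_on_def)
qed

text \<open>
  A nonempty simply connected open set is homeomorphic to the disc and hence to the plane. Lifting the homeomorphism from the plane and composing with its inverse gives a section.
\<close>

lemma section_exists:
  assumes W: "open W" "simply_connected W" "W \<subseteq> B" and x: "x \<in> topspace X" "f x = Some w" "w \<in> W"
  obtains s where "section_on X f W s" "s w = x"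
proof -
  have "W homeomorphic ball (0::complex) 1"
    using simply_connected_eq_homeomorphic_to_disc[OF W(1)] W(2) x(3) by auto
  then have "W homeomorphic (UNIV :: complex set)"
    using homeomorphic_ball_UNIV[of 1 "0::complex"] homeomorphic_trans by fastforce
  then obtain q' q where h: "homeomorphism W (UNIV :: complex set) q' q"
    unfolding homeomorphic_def by blast
  then have q: "continuous_on UNIV q" "range q \<subseteq> B" "continuous_on W q'" "\<And>z. z \<in> W \<Longrightarrow> q (q' z) = z"
    using W(3) by (auto simp: homeomorphism_def)
  obtain l where l: "lift_on X f q UNIV l" "l (q' w) = x"
    using lift_plane[OF q(1,2) x(1), of "q' w"] x q(4) by auto
  have "continuous_map (top_of_set W) X (l \<circ> q')"
    using l(1) q(3) by (intro continuous_map_compose[of _ euclidean]) (auto simp: lift_on_def)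
  then have "section_on X f W (l \<circ> q')"
    using l(1) q(4) by (auto simp: section_on_def lift_on_def)
  then show ?thesis using that l(2) by auto
qed

end

section \<open>The Riemann sphere and charts\<close>

lemma topspace_riemann_sphere [simp]: "topspace (surf_top riemann_sphere) = UNIV"
  by (simp add: riemann_sphere_def UNIV_option_conv)

lemma Hausdorff_riemann_sphere: "Hausdorff_space (surf_top riemann_sphere)"
  by (simp add: riemann_sphere_def Hausdorff_space_Alexandroff_compactification locally_compact_space_euclidean)

lemma openin_riemann_sphere_Some [simp]: "openin (surf_top riemann_sphere) (Some ` U) \<longleftrightarrow> open U"
  by (simp add: riemann_sphere_def)

lemma open_Some_preimage: "openin (surf_top riemann_sphere) V \<Longrightarrow> open {z. Some z \<in> V}"
  using openin_continuous_map_preimage[OF continuous_map_Some[of euclidean], of V]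
  by (simp add: riemann_sphere_def)

lemma open_reciprocal_preimage:
  assumes "open (U :: complex set)"
  shows "open {z. z \<noteq> 0 \<and> 1 / z \<in> U}"
proof -
  have "open ({z. z \<noteq> 0} \<inter> (\<lambda>z. 1 / z) -` U)"
    using assms by (intro continuous_open_preimage continuous_intros open_Collect_neq) auto
  then show ?thesis by (simp add: vimage_def Collect_conj_eq)
qed

lemma sphere_inverse_involution [simp]: "sphere_inverse (sphere_inverse p) = p"
  by (auto simp: sphere_inverse_def split: option.splits if_splits)

text \<open>
  Only the points \<open>None\<close> and \<open>Some 0\<close> need care: neighbourhoods of infinity are complements of compact, hence
  bounded, sets, and inversion exchanges these with neighbourhoods of 0.
\<close>

lemma continuous_map_sphere_inverse:
  "continuous_map (surf_top riemann_sphere) (surf_top riemann_sphere) sphere_inverse"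
proof -
  let ?S = "surf_top riemann_sphere"
  let ?I = "\<lambda>V. {p. sphere_inverse p \<in> V}"
  have "openin ?S (?I V)" if V: "openin ?S V" for V
  proof (subst openin_subopen, intro ballI)
    fix p assume "p \<in> ?I V"
    then have p: "sphere_inverse p \<in> V" by simp
    let ?V = "{z. Some z \<in> V}"
    consider "p = None" | "p = Some 0" | z where "p = Some z" "z \<noteq> 0"
      by (cases p) auto
    then show "\<exists>N. openin ?S N \<and> p \<in> N \<and> N \<subseteq> ?I V"
    proof cases
      case 1
      then have "0 \<in> ?V" using p by (simp add: sphere_inverse_def)
      then obtain e where e: "e > 0" "ball 0 e \<subseteq> ?V"
        using open_Some_preimage[OF V] openE by metis
      have *: "Some z \<in> - Some ` cball 0 (1 / e) \<Longrightarrow> sphere_inverse (Some z) \<in> V" for z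
      proof -
        assume "Some z \<in> - Some ` cball 0 (1 / e)"
        then have "norm z > 1 / e" by auto
        moreover from this e(1) have "norm z > 0" by (smt (verit) divide_pos_pos)
        ultimately have "z \<noteq> 0" "norm (1 / z) < e"
          using e(1) by (auto simp: norm_divide field_simps)
        then show ?thesis using e(2) by (auto simp: sphere_inverse_def)
      qed
      have "sphere_inverse None \<in> V" using p 1 by simp
      have "- Some ` cball 0 (1 / e) \<subseteq> ?I V"
      proof (intro subsetI)
        fix p' :: "complex option" assume "p' \<in> - Some ` cball 0 (1 / e)"
        then show "p' \<in> ?I V" using * \<open>sphere_inverse None \<in> V\<close> by (cases p') auto
      qed
      moreover have "closedin ?S (Some ` cball 0 (1 / e))"
        by (simp add: riemann_sphere_def)
      then have "openin ?S (- Some ` cball 0 (1 / e))"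
        by (metis Compl_eq_Diff_UNIV openin_closedin_eq openin_diff openin_topspace topspace_riemann_sphere)
      moreover have "p \<in> - Some ` cball 0 (1 / e)" using 1 by auto
      ultimately show ?thesis by blast
    next
      case 2
      then have "None \<in> V" using p by (simp add: sphere_inverse_def)
      then obtain C where C: "compact C" "V = insert None (Some ` (- C))"
        using V unfolding riemann_sphere_def by (auto simp: openin_Alexandroff_compactification Compl_eq_Diff_UNIV)
      then obtain R where R: "R > 0" "\<And>z. z \<in> C \<Longrightarrow> norm z \<le> R"
        using compact_imp_bounded bounded_pos by metis
      have "sphere_inverse (Some z) \<in> V" if "norm z < 1 / R" for z
      proof (cases "z = 0")
        case False
        then have "norm (1 / z) > R" using that R(1) by (simp add: norm_divide field_simps)
        then have "1 / z \<notin> C" using R(2)[of "1 / z"] by linarith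
        then show ?thesis using False C by (simp add: sphere_inverse_def)
      qed (use \<open>None \<in> V\<close> in \<open>simp add: sphere_inverse_def\<close>)
      then have "Some ` ball 0 (1 / R) \<subseteq> ?I V" by auto
      moreover have "p \<in> Some ` ball 0 (1 / R)" using 2 R(1) by auto
      ultimately show ?thesis
        using openin_riemann_sphere_Some[of "ball 0 (1 / R)"] open_ball by blast
    next
      case 3
      have "Some ` {z. z \<noteq> 0 \<and> 1 / z \<in> ?V} \<subseteq> ?I V"
        by (auto simp: sphere_inverse_def)
      moreover have "p \<in> Some ` {z. z \<noteq> 0 \<and> 1 / z \<in> ?V}"
        using 3 p by (auto simp: sphere_inverse_def)
      ultimately show ?thesis
        using open_reciprocal_preimage[OF open_Some_preimage[OF V]] openin_riemann_sphere_Some by blast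
    qed
  qed
  then show ?thesis by (auto simp: continuous_map_def)
qed

lemma chart_properties:
  assumes X: "riemann_surface X" and c: "(U, \<phi>) \<in> charts X"
  shows "openin (surf_top X) U" "U \<subseteq> topspace (surf_top X)" "inj_on \<phi> U" "open (\<phi> ` U)"
    "\<And>V. open V \<Longrightarrow> openin (surf_top X) {x \<in> U. \<phi> x \<in> V}"
    "\<And>N. openin (surf_top X) N \<Longrightarrow> N \<subseteq> U \<Longrightarrow> open (\<phi> ` N)"
    "homeomorphic_maps (subtopology (surf_top X) U) (top_of_set (\<phi> ` U)) \<phi> (inv_into U \<phi>)"
proof -
  have h: "openin (surf_top X) U" "open (\<phi> ` U)"
      "homeomorphic_map (subtopology (surf_top X) U) (top_of_set (\<phi> ` U)) \<phi>"
    using X c unfolding riemann_surface_def by blast+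
  show U: "openin (surf_top X) U" "open (\<phi> ` U)" by fact+
  show Us: "U \<subseteq> topspace (surf_top X)" using h(1) by (rule openin_subset)
  then have ts: "topspace (subtopology (surf_top X) U) = U" by auto
  show inj: "inj_on \<phi> U" using homeomorphic_imp_injective_map[OF h(3)] ts by simp
  have cont: "continuous_map (subtopology (surf_top X) U) (top_of_set (\<phi> ` U)) \<phi>"
    using h(3) by (rule homeomorphic_imp_continuous_map)
  show "openin (surf_top X) {x \<in> U. \<phi> x \<in> V}" if "open V" for V
  proof -
    have "openin (subtopology (surf_top X) U) {x \<in> topspace (subtopology (surf_top X) U). \<phi> x \<in> \<phi> ` U \<inter> V}"
      using cont that by (intro openin_continuous_map_preimage) (auto simp: openin_open)
    also have "{x \<in> topspace (subtopology (surf_top X) U). \<phi> x \<in> \<phi> ` U \<inter> V} = {x \<in> U. \<phi> x \<in> V}"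
      using ts by auto
    finally show ?thesis using h(1) openin_trans_full by blast
  qed
  show "open (\<phi> ` N)" if "openin (surf_top X) N" "N \<subseteq> U" for N
  proof -
    have "openin (subtopology (surf_top X) U) N"
      using that by (metis inf.absorb1 openin_subtopology_Int)
    then have "openin (top_of_set (\<phi> ` U)) (\<phi> ` N)"
      using h(3) homeomorphic_imp_open_map open_map_def by blast
    then show ?thesis using h(2) openin_open_trans by blast
  qed
  show "homeomorphic_maps (subtopology (surf_top X) U) (top_of_set (\<phi> ` U)) \<phi> (inv_into U \<phi>)"
  proof -
    obtain g where g: "homeomorphic_maps (subtopology (surf_top X) U) (top_of_set (\<phi> ` U)) \<phi> g"
      using h(3) homeomorphic_map_maps by blast
    then have "g z = inv_into U \<phi> z" if "z \<in> \<phi> ` U" for z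
      using that inj ts by (auto simp: homeomorphic_maps_def)
    then show ?thesis
      using homeomorphic_maps_eq[OF g, of \<phi> "inv_into U \<phi>"] by auto
  qed
qed

lemma chart_at_properties:
  assumes "riemann_surface X" "x \<in> topspace (surf_top X)"
  shows "chart_at X x \<in> charts X" "x \<in> fst (chart_at X x)"
proof -
  have "\<exists>c. c \<in> charts X \<and> x \<in> fst c"
    using assms by (force simp: riemann_surface_def)
  then show "chart_at X x \<in> charts X" "x \<in> fst (chart_at X x)"
    unfolding chart_at_def by (metis (mono_tags, lifting) someI_ex)+
qed

text \<open>
  The two differences are related by the factor \<open>- 1 / (F z * F z0)\<close>, which does not vanish at \<open>z0\<close>. This is why
  the ramification index at a point whose value is neither 0 nor infinity is the same in both charts of the sphere.
\<close>

lemma zorder_reciprocal: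
  assumes F: "F holomorphic_on S" "open S" "z0 \<in> S" "F z0 \<noteq> 0"
    and ne: "eventually (\<lambda>z. F z \<noteq> F z0) (at z0)"
  shows "zorder (\<lambda>z. 1 / F z - 1 / F z0) z0 = zorder (\<lambda>z. F z - F z0) z0"
proof -
  have an: "F analytic_on {z0}" using F analytic_at by blast
  then have "isCont F z0" by (simp add: analytic_at_imp_isCont)
  then have nz: "eventually (\<lambda>z. F z \<noteq> 0) (at z0)"
    using F(4) by (simp add: isCont_def tendsto_imp_eventually_ne)
  let ?g = "\<lambda>z. - 1 / (F z * F z0)"
  have g: "?g analytic_on {z0}" using an F(4) by (intro analytic_intros) auto
  have "zorder (\<lambda>z. 1 / F z - 1 / F z0) z0 = zorder (\<lambda>z. (F z - F z0) * ?g z) z0"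
    using nz F(4) by (intro zorder_cong) (auto elim!: eventually_mono simp: field_simps)
  also have "\<dots> = zorder (\<lambda>z. F z - F z0) z0 + zorder ?g z0"
  proof (rule zorder_times_analytic)
    show "(\<lambda>z. F z - F z0) analytic_on {z0}" using an by (intro analytic_intros)
    show "eventually (\<lambda>z. (F z - F z0) * ?g z \<noteq> 0) (at z0)"
      using ne nz by eventually_elim (use F(4) in auto)
  qed (rule g)
  also have "zorder ?g z0 = 0"
    using g F(4) by (intro zorder_eq_0I) auto
  finally show ?thesis by simp
qed


section \<open>Branched coverings of the sphere and their duals\<close>

text \<open>
  A dessin without the condition on its branch points. Everything up to the local normal form holds in this
  generality, which is needed to see that the dual of a dessin satisfies that condition.
\<close>

locale branched_map =
  fixes X :: "'a surface" and f :: "'a \<Rightarrow> complex option"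
  assumes surface: "riemann_surface X"
    and compact: "compact_space (surf_top X)" and connected: "connected_space (surf_top X)"
    and holomorphic: "holomorphic_map X riemann_sphere f"
    and nonconstant: "\<not> (\<exists>c. \<forall>x\<in>topspace (surf_top X). f x = c)"
begin

abbreviation "T \<equiv> surf_top X"

lemma Hausdorff: "Hausdorff_space T"
  using surface by (simp add: riemann_surface_def)

lemma continuous: "continuous_map T (surf_top riemann_sphere) f"
  using holomorphic by (simp add: holomorphic_map_def)

lemma open_preimage: "open V \<Longrightarrow> openin T {x \<in> topspace T. f x \<in> Some ` V}"
  using openin_continuous_map_preimage[OF continuous, of "Some ` V"] by simp

lemma closed_fibre: "closedin T {x \<in> topspace T. f x = p}"
proof -
  have "closedin (surf_top riemann_sphere) {p}"
    using Hausdorff_riemann_sphere by (simp add: closedin_Hausdorff_singleton)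
  from closedin_continuous_map_preimage[OF continuous this] show ?thesis by simp
qed

text \<open>
  Compactness of the surface makes \<open>f\<close> a closed map, so neighbourhoods of a fibre contain preimages of discs.
\<close>

lemma fibre_neighbourhood:
  assumes W: "openin T W" and fib: "\<And>x. x \<in> topspace T \<Longrightarrow> f x = Some a \<Longrightarrow> x \<in> W"
  obtains \<delta> where "\<delta> > 0" "\<And>x. x \<in> topspace T \<Longrightarrow> f x \<in> Some ` ball a \<delta> \<Longrightarrow> x \<in> W"
proof -
  have "closed_map T (surf_top riemann_sphere) f"
    by (rule continuous_imp_closed_map[OF continuous compact Hausdorff_riemann_sphere])
  then have "closedin (surf_top riemann_sphere) (f ` (topspace T - W))"
    using W by (simp add: closed_map_def closedin_diff)
  then have op: "openin (surf_top riemann_sphere) (- f ` (topspace T - W))"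
    by (simp add: closedin_def Compl_eq_Diff_UNIV)
  have "a \<in> {z. Some z \<in> - f ` (topspace T - W)}" using fib by (auto simp: image_iff)
  then obtain \<delta> where \<delta>: "\<delta> > 0" "ball a \<delta> \<subseteq> {z. Some z \<in> - f ` (topspace T - W)}"
    using open_Some_preimage[OF op] openE by metis
  show ?thesis
  proof (rule that[OF \<delta>(1)])
    fix x assume "x \<in> topspace T" "f x \<in> Some ` ball a \<delta>"
    then show "x \<in> W" using \<delta>(2) by (auto simp: image_iff subset_iff) (metis DiffI)
  qed
qed

lemma coordinate_holomorphic:
  assumes c: "(U, \<phi>) \<in> charts X"
  shows "open (\<phi> ` (U \<inter> {x. f x \<noteq> None}))"
    "(\<lambda>z. the (f (inv_into U \<phi> z))) holomorphic_on \<phi> ` (U \<inter> {x. f x \<noteq> None})"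
proof -
  note ch = chart_properties[OF surface c]
  have "U \<inter> {x. f x \<noteq> None} = U \<inter> {x \<in> topspace T. f x \<in> Some ` UNIV}"
    using ch(2) by auto
  then have "openin T (U \<inter> {x. f x \<noteq> None})"
    using ch(1) open_preimage[of UNIV] by auto
  then show "open (\<phi> ` (U \<inter> {x. f x \<noteq> None}))" using ch(6) by auto
  have "(- {None}, the) \<in> charts riemann_sphere" by (simp add: riemann_sphere_def)
  then have "(the \<circ> f \<circ> inv_into U \<phi>) holomorphic_on \<phi> ` (U \<inter> f -` (- {None}))"
    using holomorphic c unfolding holomorphic_map_def by blast
  then show "(\<lambda>z. the (f (inv_into U \<phi> z))) holomorphic_on \<phi> ` (U \<inter> {x. f x \<noteq> None})"
    by (simp add: comp_def vimage_def)
qed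

text \<open>
  The identity theorem on the surface: the set of points near which \<open>f\<close> is constantly \<open>c\<close> is open, and closed by
  analytic continuation in a chart; it is not everything since \<open>f\<close> is not constant.
\<close>

lemma nowhere_locally_constant:
  assumes N: "openin T N" "x \<in> N" and x: "f x = Some c"
  shows "\<exists>y\<in>N. f y \<noteq> f x"
proof (rule ccontr)
  assume const: "\<not> ?thesis"
  define A where "A = {x \<in> topspace T. \<exists>N. openin T N \<and> x \<in> N \<and> (\<forall>y\<in>N. f y = Some c)}"
  have opA: "openin T A"
  proof (subst openin_subopen, intro ballI)
    fix y assume "y \<in> A"
    then obtain M where M: "openin T M" "y \<in> M" "\<forall>y\<in>M. f y = Some c" by (auto simp: A_def)
    then have "M \<subseteq> A" using openin_subset[OF M(1)] by (auto simp: A_def)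
    then show "\<exists>M. openin T M \<and> y \<in> M \<and> M \<subseteq> A" using M by blast
  qed
  have "T closure_of A \<subseteq> A"
  proof
    fix y assume y: "y \<in> T closure_of A"
    then have yT: "y \<in> topspace T" by (meson closure_of_subset_topspace subsetD)
    have "A \<subseteq> {x \<in> topspace T. f x = Some c}" by (auto simp: A_def)
    then have "T closure_of A \<subseteq> {x \<in> topspace T. f x = Some c}"
      using closed_fibre by (rule closure_of_minimal)
    then have fy: "f y = Some c" using y by auto
    obtain U \<phi> where c: "(U, \<phi>) \<in> charts X" "y \<in> U"
      using chart_at_properties[OF surface yT] by (metis prod.collapse)
    note ch = chart_properties[OF surface c(1)]
    let ?S = "\<phi> ` (U \<inter> {x. f x \<noteq> None})" and ?F = "\<lambda>z. the (f (inv_into U \<phi> z))"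
    have "\<phi> y \<in> ?S" using c(2) fy by auto
    then obtain e where e: "e > 0" "ball (\<phi> y) e \<subseteq> ?S"
      using coordinate_holomorphic(1)[OF c(1)] openE by metis
    define M where "M = {x \<in> U. \<phi> x \<in> ball (\<phi> y) e}"
    have M: "openin T M" "y \<in> M" using ch(5)[of "ball (\<phi> y) e"] c(2) e(1) by (auto simp: M_def)
    then obtain z where z: "z \<in> A" "z \<in> M" using y by (auto simp: in_closure_of)
    then obtain L where L: "openin T L" "z \<in> L" "\<forall>y\<in>L. f y = Some c" by (auto simp: A_def)
    have op: "open (\<phi> ` (M \<inter> L))" using ch(6) M(1) L(1) by (auto simp: M_def)
    have F: "?F (\<phi> x) = the (f x)" if "x \<in> U" for x using ch(3) that by simp
    have "?F w = c" if "w \<in> ball (\<phi> y) e" for w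
    proof (rule analytic_continuation_open[OF op open_ball[of "\<phi> y" e], of ?F "\<lambda>_. c"])
      show "?F holomorphic_on ball (\<phi> y) e"
        using coordinate_holomorphic(2)[OF c(1)] e(2) by (rule holomorphic_on_subset)
      show "\<phi> ` (M \<inter> L) \<noteq> {}" using z(2) L(2) by blast
      show "?F w = c" if "w \<in> \<phi> ` (M \<inter> L)" for w using that F L(3) by (auto simp: M_def)
    qed (use that in \<open>auto simp: M_def\<close>)
    moreover have "f x \<noteq> None" if "x \<in> M" for x
    proof -
      have "\<phi> x \<in> ?S" "x \<in> U" using that e(2) by (auto simp: M_def)
      then show ?thesis using ch(3) by (auto simp: inj_on_def)
    qed
    ultimately have "f x = Some c" if "x \<in> M" for x
      using that F[of x] by (auto simp: M_def)
    then show "y \<in> A" using M yT by (auto simp: A_def)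
  qed
  moreover have "A \<subseteq> topspace T" by (auto simp: A_def)
  ultimately have "closedin T A" by (simp flip: closure_of_subset_eq)
  moreover have "x \<in> A" using const x N openin_subset[OF N(1)] by (auto simp: A_def)
  ultimately have "A = topspace T"
    using connected opA by (auto simp: connected_space_clopen_in)
  then have "\<forall>x\<in>topspace T. f x = Some c" by (auto simp: A_def)
  then show False using nonconstant by blast
qed


text \<open>
  A coordinate \<open>w\<close> on a neighbourhood \<open>N\<close> of \<open>v\<close>, with inverse \<open>w'\<close>, in which \<open>f\<close> is \<open>a + w ^ k\<close>.
\<close>

definition power_chart ::
    "complex \<Rightarrow> 'a \<Rightarrow> nat \<Rightarrow> real \<Rightarrow> 'a set \<Rightarrow> ('a \<Rightarrow> complex) \<Rightarrow> (complex \<Rightarrow> 'a) \<Rightarrow> bool" where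
  "power_chart a v k r N w w' \<longleftrightarrow> 0 < k \<and> 0 < r \<and> openin T N \<and> v \<in> N \<and> w v = 0 \<and>
     homeomorphic_maps (subtopology T N) (top_of_set (ball 0 r)) w w' \<and>
     (\<forall>y\<in>N. f y = Some (a + w y ^ k)) \<and>
     ramification_index X riemann_sphere f v = k"

text \<open>
  For a value other than 0 and infinity the chart of the sphere in the definition of the ramification index may
  be either of the two; in both cases the result is the order in the coordinate \<open>z\<close>.
\<close>

lemma ramification_index_eq:
  assumes x: "x \<in> topspace T" "f x = Some a" and ch: "chart_at X x = (U, \<phi>)"
    and ev: "eventually (\<lambda>z. the (f (inv_into U \<phi> z)) \<noteq> a) (at (\<phi> x))"
  shows "ramification_index X riemann_sphere f x =
    nat (zorder (\<lambda>z. the (f (inv_into U \<phi> z)) - a) (\<phi> x))"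
proof -
  let ?F = "\<lambda>z. the (f (inv_into U \<phi> z))"
  have c: "(U, \<phi>) \<in> charts X" "x \<in> U"
    using chart_at_properties[OF surface x(1)] ch by auto
  let ?S = "\<phi> ` (U \<inter> {x. f x \<noteq> None})"
  have S: "open ?S" "?F holomorphic_on ?S" using coordinate_holomorphic[OF c(1)] by auto
  have xS: "\<phi> x \<in> ?S" using c(2) x(2) by auto
  have inv: "inv_into U \<phi> (\<phi> y) = y" if "y \<in> U" for y
    using chart_properties(3)[OF surface c(1)] that by simp
  let ?rec = "\<lambda>p::complex option. (case p of None \<Rightarrow> 0 | Some z \<Rightarrow> 1 / z)"
  have "chart_at riemann_sphere (f x) \<in> {c. c \<in> charts riemann_sphere \<and> f x \<in> fst c}"
    unfolding chart_at_def mem_Collect_eq by (rule someI[of _ "(- {None}, the)"]) (use x(2) in \<open>simp add: riemann_sphere_def\<close>)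
  then consider "chart_at riemann_sphere (f x) = (- {None}, the)"
    | "chart_at riemann_sphere (f x) = (- {Some 0}, ?rec)" "a \<noteq> 0"
    using x(2) by (auto simp: riemann_sphere_def)
  then show ?thesis
  proof cases
    case 1
    then show ?thesis by (simp add: ramification_index_def ch x(2))
  next
    case 2
    have "zorder (\<lambda>z. ?rec (f (inv_into U \<phi> z)) - 1 / a) (\<phi> x) = zorder (\<lambda>z. 1 / ?F z - 1 / ?F (\<phi> x)) (\<phi> x)"
    proof (rule zorder_cong)
      have "eventually (\<lambda>z. z \<in> ?S) (at (\<phi> x))"
        using S(1) xS by (rule eventually_at_in_open')
      then show "eventually (\<lambda>z. ?rec (f (inv_into U \<phi> z)) - 1 / a = 1 / ?F z - 1 / ?F (\<phi> x)) (at (\<phi> x))"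
        by eventually_elim (use inv c(2) x(2) in \<open>auto split: option.splits\<close>)
    qed simp
    also have "\<dots> = zorder (\<lambda>z. ?F z - ?F (\<phi> x)) (\<phi> x)"
      using S xS ev inv[OF c(2)] x(2) 2(2) by (intro zorder_reciprocal[of _ ?S]) auto
    finally show ?thesis using 2 inv[OF c(2)] by (simp add: ramification_index_def ch x(2))
  qed
qed

lemma power_chart_exists:
  assumes x: "x \<in> topspace T" "f x = Some a" and ch: "chart_at X x = (U, \<phi>)" and R: "0 < R"
  obtains k r N w w' g where "power_chart a x k r N w w'" "r \<le> R" "N \<subseteq> U"
    "\<And>y. y \<in> N \<Longrightarrow> w y = (\<phi> y - \<phi> x) * g (\<phi> y)" "isCont g (\<phi> x)" "\<And>y. y \<in> N \<Longrightarrow> g (\<phi> y) \<noteq> 0"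
    "eventually (\<lambda>z. the (f (inv_into U \<phi> z)) \<noteq> a) (at (\<phi> x))"
proof -
  let ?F = "\<lambda>z. the (f (inv_into U \<phi> z))"
  have c: "(U, \<phi>) \<in> charts X" "x \<in> U"
    using chart_at_properties[OF surface x(1)] ch by auto
  note cp = chart_properties[OF surface c(1)]
  let ?S = "\<phi> ` (U \<inter> {x. f x \<noteq> None})"
  have S: "open ?S" "?F holomorphic_on ?S" using coordinate_holomorphic[OF c(1)] by auto
  have xS: "\<phi> x \<in> ?S" using c(2) x(2) by auto
  have inv: "inv_into U \<phi> (\<phi> y) = y" if "y \<in> U" for y
    using cp(3) that by simp
  have finite_value: "f y \<noteq> None" if "y \<in> U" "\<phi> y \<in> ?S" for y
    using that cp(3) by (auto simp: inj_on_def)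
  have nonconst: "\<exists>z\<in>V. ?F z \<noteq> ?F (\<phi> x)" if V: "open V" "\<phi> x \<in> V" "V \<subseteq> ?S" for V
  proof -
    obtain y where y: "y \<in> U" "\<phi> y \<in> V" "f y \<noteq> f x"
      using nowhere_locally_constant[OF cp(5)[OF V(1)] _ x(2)] V(2) c(2) by auto
    have "f y \<noteq> None" using finite_value y V by auto
    then have "?F (\<phi> y) \<noteq> ?F (\<phi> x)" using y inv c(2) x(2) by auto
    then show ?thesis using y(2) by blast
  qed
  obtain k r V g v where kr: "0 < k" "0 < r" "r \<le> R" and V: "open V" "\<phi> x \<in> V" "V \<subseteq> ?S"
    and hom: "homeomorphism V (ball 0 r) (\<lambda>z. (z - \<phi> x) * g z) v"
    and pow: "\<And>z. z \<in> V \<Longrightarrow> ?F z = ?F (\<phi> x) + ((z - \<phi> x) * g z) ^ k"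
    and g: "isCont g (\<phi> x)" "\<And>z. z \<in> V \<Longrightarrow> g z \<noteq> 0"
    and zo: "zorder (\<lambda>z. ?F z - ?F (\<phi> x)) (\<phi> x) = int k"
    using holomorphic_local_power_form[OF S(2,1) xS nonconst R] by blast
  have Fx: "?F (\<phi> x) = a" using inv c(2) x(2) by simp
  define N where "N = {y \<in> U. \<phi> y \<in> V}"
  define w where "w = (\<lambda>y. (\<phi> y - \<phi> x) * g (\<phi> y))"
  have N: "openin T N" "x \<in> N" "N \<subseteq> U" using cp(5)[OF V(1)] c(2) V(2) by (auto simp: N_def)
  have "\<phi> ` N = V" using V(3) by (auto simp: N_def)
  then have "homeomorphic_maps (subtopology (subtopology T U) N) (subtopology (top_of_set (\<phi> ` U)) V) \<phi> (inv_into U \<phi>)"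
    using cp(2) N(3) by (intro homeomorphic_maps_subtopologies[OF cp(7)]) auto
  moreover have "U \<inter> N = N" "\<phi> ` U \<inter> V = V" using N(3) \<open>\<phi> ` N = V\<close> by auto
  ultimately have h1: "homeomorphic_maps (subtopology T N) (top_of_set V) \<phi> (inv_into U \<phi>)"
    by (simp add: subtopology_subtopology)
  have h2: "homeomorphic_maps (top_of_set V) (top_of_set (ball 0 r)) (\<lambda>z. (z - \<phi> x) * g z) v"
    using hom unfolding homeomorphism_def homeomorphic_maps_def by auto
  have "homeomorphic_maps (subtopology T N) (top_of_set (ball 0 r)) w (inv_into U \<phi> \<circ> v)"
    using homeomorphic_maps_compose[OF conjI[OF h1 h2]] by (simp add: w_def comp_def)
  moreover have "f y = Some (a + w y ^ k)" if "y \<in> N" for y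
  proof -
    have "f y \<noteq> None" using finite_value that V(3) by (auto simp: N_def)
    then show ?thesis
      using pow[of "\<phi> y"] that inv[of y] Fx x(2) by (auto simp: N_def w_def)
  qed
  moreover have "eventually (\<lambda>z. z \<in> V - {\<phi> x}) (at (\<phi> x))"
    using V by (intro eventually_at_in_open) auto
  then have ev: "eventually (\<lambda>z. ?F z \<noteq> a) (at (\<phi> x))"
  proof eventually_elim
    case (elim z)
    then have "((z - \<phi> x) * g z) ^ k \<noteq> 0" using g(2)[of z] by simp
    then show ?case using pow[of z] Fx elim by simp
  qed
  then have "ramification_index X riemann_sphere f x = k"
    using ramification_index_eq[OF x ch] zo Fx by simp
  ultimately have pc: "power_chart a x k r N w (inv_into U \<phi> \<circ> v)"
    using kr(1,2) N(1,2) unfolding power_chart_def by (intro conjI ballI) (simp_all add: w_def)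
  show ?thesis
    by (rule that[OF pc kr(3) N(3) _ g(1) _ ev]) (use g(2) in \<open>simp_all add: w_def N_def\<close>)
qed

lemma dual_branched_map: "branched_map X (dual_map f)"
proof
  let ?rec = "\<lambda>p::complex option. (case p of None \<Rightarrow> 0 | Some z \<Rightarrow> 1 / z)"
  have charts: "(- {None}, the) \<in> charts riemann_sphere" "(- {Some 0}, ?rec) \<in> charts riemann_sphere"
    by (simp_all add: riemann_sphere_def)
  have "(\<psi> \<circ> dual_map f \<circ> inv_into U \<phi>) holomorphic_on \<phi> ` (U \<inter> dual_map f -` V)"
    if c: "(U, \<phi>) \<in> charts X" and d: "(V, \<psi>) \<in> charts riemann_sphere" for U \<phi> V \<psi>
  proof -
    have inv: "inv_into U \<phi> (\<phi> y) = y" if "y \<in> U" for y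
      using chart_properties(3)[OF surface c] that by simp
    consider "V = - {None}" "\<psi> = the" | "V = - {Some 0}" "\<psi> = ?rec"
      using d by (auto simp: riemann_sphere_def)
    then show ?thesis
    proof cases
      case 1
      have "U \<inter> dual_map f -` V = U \<inter> f -` (- {Some 0})"
        using 1 by (auto simp: dual_map_def sphere_inverse_def split: option.splits if_splits)
      moreover have "(?rec \<circ> f \<circ> inv_into U \<phi>) holomorphic_on \<phi> ` (U \<inter> f -` (- {Some 0}))"
        using holomorphic c charts unfolding holomorphic_map_def by blast
      then have "(\<psi> \<circ> dual_map f \<circ> inv_into U \<phi>) holomorphic_on \<phi> ` (U \<inter> f -` (- {Some 0}))"
        by (rule holomorphic_transform)
          (use inv 1 in \<open>auto simp: dual_map_def sphere_inverse_def split: option.splits\<close>)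
      ultimately show ?thesis by simp
    next
      case 2
      have "U \<inter> dual_map f -` V = U \<inter> f -` (- {None})"
        using 2 by (auto simp: dual_map_def sphere_inverse_def split: option.splits if_splits)
      moreover have "(the \<circ> f \<circ> inv_into U \<phi>) holomorphic_on \<phi> ` (U \<inter> f -` (- {None}))"
        using holomorphic c charts unfolding holomorphic_map_def by blast
      then have "(\<psi> \<circ> dual_map f \<circ> inv_into U \<phi>) holomorphic_on \<phi> ` (U \<inter> f -` (- {None}))"
        by (rule holomorphic_transform)
          (use inv 2 in \<open>auto simp: dual_map_def sphere_inverse_def split: option.splits\<close>)
      ultimately show ?thesis by simp
    qed
  qed
  then show "holomorphic_map X riemann_sphere (dual_map f)"
    unfolding holomorphic_map_def dual_map_def
    using continuous_map_compose[OF continuous continuous_map_sphere_inverse] by blast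
  show "\<not> (\<exists>c. \<forall>x\<in>topspace T. dual_map f x = c)"
    using nonconstant unfolding dual_map_def by (metis comp_apply sphere_inverse_involution)
qed (use surface compact connected in auto)

text \<open>
  At a face centre both sides use the same local function: the chart at infinity composed with \<open>f\<close> is the chart
  at zero composed with \<open>1 / f\<close>. Elsewhere the orders agree because \<open>1 / F - 1 / F z0\<close> is a unit times \<open>F - F z0\<close>.
\<close>

lemma ramification_index_dual_map:
  assumes x: "x \<in> topspace T" and fx: "f x \<noteq> Some 0"
  shows "ramification_index X riemann_sphere (dual_map f) x = ramification_index X riemann_sphere f x"
proof -
  interpret D: branched_map X "dual_map f" by (rule dual_branched_map)
  obtain U \<phi> where ch: "chart_at X x = (U, \<phi>)" by fastforce
  have c: "(U, \<phi>) \<in> charts X" "x \<in> U"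
    using chart_at_properties[OF surface x] ch by auto
  have inv: "inv_into U \<phi> (\<phi> y) = y" if "y \<in> U" for y
    using chart_properties(3)[OF surface c(1)] that by simp
  show ?thesis
  proof (cases "f x")
    case None
    let ?rec = "\<lambda>p::complex option. (case p of None \<Rightarrow> 0 | Some z \<Rightarrow> 1 / z)"
    have "chart_at riemann_sphere (f x) = (- {Some 0}, ?rec)"
      unfolding chart_at_def None by (rule some_equality) (auto simp: riemann_sphere_def)
    moreover have "chart_at riemann_sphere (Some 0) = (- {None}, the)"
      unfolding chart_at_def by (rule some_equality) (auto simp: riemann_sphere_def)
    moreover have "zorder (\<lambda>z. the (dual_map f (inv_into U \<phi> z))) (\<phi> x) = zorder (\<lambda>z. ?rec (f (inv_into U \<phi> z))) (\<phi> x)"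
    proof (rule zorder_cong)
      let ?S = "\<phi> ` (U \<inter> {x. dual_map f x \<noteq> None})"
      have "\<phi> x \<in> ?S" using c(2) None by (auto simp: dual_map_def sphere_inverse_def)
      then have "eventually (\<lambda>z. z \<in> ?S) (at (\<phi> x))"
        by (rule eventually_at_in_open'[OF D.coordinate_holomorphic(1)[OF c(1)]])
      then show "eventually (\<lambda>z. the (dual_map f (inv_into U \<phi> z)) = ?rec (f (inv_into U \<phi> z))) (at (\<phi> x))"
        by eventually_elim (use inv in \<open>auto simp: dual_map_def sphere_inverse_def split: option.splits\<close>)
    qed simp
    ultimately show ?thesis
      by (simp add: ramification_index_def ch None dual_map_def sphere_inverse_def)
  next
    case (Some a)
    then have a: "a \<noteq> 0" "dual_map f x = Some (1 / a)"
      using fx by (auto simp: dual_map_def sphere_inverse_def)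
    let ?F = "\<lambda>z. the (f (inv_into U \<phi> z))" and ?G = "\<lambda>z. the (dual_map f (inv_into U \<phi> z))"
    let ?S = "\<phi> ` (U \<inter> {x. f x \<noteq> None})"
    have S: "open ?S" "?F holomorphic_on ?S" using coordinate_holomorphic[OF c(1)] by auto
    have xS: "\<phi> x \<in> ?S" using c(2) Some by auto
    have Fx: "?F (\<phi> x) = a" using inv c(2) Some by simp
    have "eventually (\<lambda>z. ?F z \<noteq> a) (at (\<phi> x))"
      using power_chart_exists[OF x Some ch, of 1] by (metis zero_less_one)
    moreover have "eventually (\<lambda>z. ?G z \<noteq> 1 / a) (at (\<phi> x))"
      using D.power_chart_exists[OF x a(2) ch, of 1] by (metis zero_less_one)
    moreover have "zorder (\<lambda>z. ?G z - 1 / a) (\<phi> x) = zorder (\<lambda>z. 1 / ?F z - 1 / ?F (\<phi> x)) (\<phi> x)"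
    proof (rule zorder_cong)
      have "isCont ?F (\<phi> x)"
        using S xS by (metis continuous_on_eq_continuous_at holomorphic_on_imp_continuous_on)
      then have "eventually (\<lambda>z. ?F z \<noteq> 0) (at (\<phi> x))"
        using a(1) Fx by (simp add: isCont_def tendsto_imp_eventually_ne)
      moreover have "eventually (\<lambda>z. z \<in> ?S) (at (\<phi> x))"
        using S(1) xS by (rule eventually_at_in_open')
      ultimately show "eventually (\<lambda>z. ?G z - 1 / a = 1 / ?F z - 1 / ?F (\<phi> x)) (at (\<phi> x))"
        by eventually_elim (use inv Fx in \<open>auto simp: dual_map_def sphere_inverse_def\<close>)
    qed simp
    ultimately show ?thesis
      using zorder_reciprocal[OF S(2,1) xS] ramification_index_eq[OF x Some ch]
        D.ramification_index_eq[OF x a(2) ch] Fx a(1) by simp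
  qed
qed

end

lemma dual_dessin:
  assumes D: "dessin X f"
  shows "dessin X (dual_map f)"
proof -
  interpret branched_map X f
    using D unfolding dessin_def by unfold_locales auto
  interpret D: branched_map X "dual_map f" by (rule dual_branched_map)
  have "ramification_index X riemann_sphere (dual_map f) x = 1"
    if x: "x \<in> topspace T" and d: "dual_map f x \<notin> {Some 0, Some 1, None}" for x
  proof -
    have "f x \<notin> {Some 0, Some 1, None}"
      using d by (cases "f x") (auto simp: dual_map_def sphere_inverse_def)
    then show ?thesis using ramification_index_dual_map[OF x] D x by (simp add: dessin_def)
  qed
  then show ?thesis
    using D.surface D.compact D.connected D.holomorphic D.nonconstant by (simp add: dessin_def)
qed

section \<open>Fibres and limits of sections\<close>

context branched_map
begin

lemma power_chartD:
  assumes "power_chart a v k r N w w'"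
  shows "0 < k" "0 < r" "openin T N" "N \<subseteq> topspace T" "v \<in> N" "w v = 0" "f v = Some a"
    "\<And>y. y \<in> N \<Longrightarrow> f y = Some (a + w y ^ k)"
    "\<And>y. y \<in> N \<Longrightarrow> norm (w y) < r" "\<And>y. y \<in> N \<Longrightarrow> w' (w y) = y"
    "\<And>z. norm z < r \<Longrightarrow> w' z \<in> N" "\<And>z. norm z < r \<Longrightarrow> w (w' z) = z"
    "continuous_map (subtopology T N) (top_of_set (ball 0 r)) w"
    "continuous_map (top_of_set (ball 0 r)) T w'"
    "ramification_index X riemann_sphere f v = k"
proof -
  note * = assms[unfolded power_chart_def homeomorphic_maps_def]
  show N: "N \<subseteq> topspace T" "openin T N" using * openin_subset by blast+
  have ts: "topspace (subtopology T N) = N" using N by auto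
  show "0 < k" "0 < r" "v \<in> N" "w v = 0" "\<And>y. y \<in> N \<Longrightarrow> f y = Some (a + w y ^ k)"
    "ramification_index X riemann_sphere f v = k" using * by blast+
  then show "f v = Some a" by simp
  show cont: "continuous_map (subtopology T N) (top_of_set (ball 0 r)) w" using * by blast
  have cont': "continuous_map (top_of_set (ball 0 r)) (subtopology T N) w'" using * by blast
  then show "continuous_map (top_of_set (ball 0 r)) T w'" by (simp add: continuous_map_in_subtopology)
  show "norm (w y) < r" if "y \<in> N" for y
    using continuous_map_image_subset_topspace[OF cont] ts that by (auto simp: image_subset_iff)
  show "w' z \<in> N" if "norm z < r" for z
    using continuous_map_image_subset_topspace[OF cont'] ts that by (auto simp: image_subset_iff)
  show "w' (w y) = y" if "y \<in> N" for y using * ts that by blast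
  show "w (w' z) = z" if "norm z < r" for z using * that by auto
qed

lemma power_chart_closed_disc:
  assumes pc: "power_chart a v k r N w w'" and "\<rho> < r"
  shows "closedin T {y \<in> N. norm (w y) \<le> \<rho>}"
proof -
  note D = power_chartD[OF pc]
  have "cball (0::complex) \<rho> \<subseteq> ball 0 r" using \<open>\<rho> < r\<close> by auto
  then have "compactin (top_of_set (ball (0::complex) r)) (cball 0 \<rho>)"
    by (simp add: compactin_subtopology)
  then have "compactin T (w' ` cball 0 \<rho>)"
    using D(14) by (rule image_compactin)
  moreover have "w' ` cball 0 \<rho> = {y \<in> N. norm (w y) \<le> \<rho>}"
  proof (intro equalityI subsetI)
    fix y assume "y \<in> {y \<in> N. norm (w y) \<le> \<rho>}"
    then show "y \<in> w' ` cball 0 \<rho>" using D(10) by (intro image_eqI[of _ _ "w y"]) auto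
  qed (use D(11,12) \<open>\<rho> < r\<close> in auto)
  ultimately show ?thesis using compactin_imp_closedin[OF Hausdorff] by metis
qed

lemma power_chart_small_discs:
  assumes pc: "power_chart a v k r N w w'" and V: "openin T V" "v \<in> V"
  obtains \<epsilon> where "0 < \<epsilon>" "\<And>y. y \<in> N \<Longrightarrow> norm (w y) < \<epsilon> \<Longrightarrow> y \<in> V"
proof -
  note D = power_chartD[OF pc]
  have "openin (top_of_set (ball 0 r)) {z \<in> topspace (top_of_set (ball 0 r)). w' z \<in> V}"
    using D(14) V(1) by (rule openin_continuous_map_preimage)
  then have "open {z \<in> ball 0 r. w' z \<in> V}"
    using openin_open_eq[OF open_ball[of "0::complex" r]] by simp
  moreover have "w' 0 = v" using D(5,6,10) by metis
  then have "0 \<in> {z \<in> ball 0 r. w' z \<in> V}" using D(2) V(2) by simp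
  ultimately obtain \<epsilon> where \<epsilon>: "0 < \<epsilon>" "ball 0 \<epsilon> \<subseteq> {z \<in> ball 0 r. w' z \<in> V}"
    using openE by metis
  show ?thesis
  proof (rule that[OF \<epsilon>(1)])
    fix y assume y: "y \<in> N" "norm (w y) < \<epsilon>"
    then have "w' (w y) \<in> V" using \<epsilon>(2) by (auto simp: subset_iff)
    then show "y \<in> V" using D(10) y(1) by simp
  qed
qed

text \<open>
  A disc around \<open>a\<close> so small that its whole preimage lies in discs on which \<open>f\<close> is a power. The inequality
  \<open>\<delta> < r ^ k\<close> says that each of these discs maps onto more than the disc around \<open>a\<close>.
  Finitely many of them suffice because the fibre is compact.
\<close>

lemma power_charts_cover_fibre:
  obtains \<delta> where "0 < \<delta>" "\<And>x. x \<in> topspace T \<Longrightarrow> f x \<in> Some ` ball a \<delta> \<Longrightarrow>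
     \<exists>v k r N w w'. power_chart a v k r N w w' \<and> x \<in> N \<and> \<delta> < r ^ k"
proof -
  let ?P = "\<lambda>M v k r w w'. power_chart a v k r M w w'"
  define \<U> where "\<U> = {M. \<exists>v k r w w'. ?P M v k r w w'}"
  define K where "K = {x \<in> topspace T. f x = Some a}"
  have "compactin T K" unfolding K_def
    using closed_fibre compact by (metis closedin_compact_space)
  moreover have "\<forall>M\<in>\<U>. openin T M"
    unfolding \<U>_def using power_chartD(3) by blast
  moreover have "K \<subseteq> \<Union>\<U>"
  proof
    fix x assume "x \<in> K"
    then have x: "x \<in> topspace T" "f x = Some a" by (auto simp: K_def)
    obtain U \<phi> where ch: "chart_at X x = (U, \<phi>)" by fastforce
    obtain k r N w w' where "power_chart a x k r N w w'"
      using power_chart_exists[OF x ch, of 1] by (metis zero_less_one)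
    then show "x \<in> \<Union>\<U>" using power_chartD(5) unfolding \<U>_def by blast
  qed
  ultimately obtain \<F> where \<F>: "finite \<F>" "\<F> \<subseteq> \<U>" "K \<subseteq> \<Union>\<F>"
    unfolding compactin_def by meson
  have "\<forall>M\<in>\<F>. \<exists>\<epsilon>>0. \<exists>v k r w w'. ?P M v k r w w' \<and> \<epsilon> \<le> r ^ k"
  proof
    fix M assume "M \<in> \<F>"
    then obtain v k r w w' where *: "?P M v k r w w'" using \<F>(2) unfolding \<U>_def by blast
    then have "r ^ k > 0" using power_chartD(2) by simp
    then show "\<exists>\<epsilon>>0. \<exists>v k r w w'. ?P M v k r w w' \<and> \<epsilon> \<le> r ^ k" using * by blast
  qed
  then obtain \<epsilon> where \<epsilon>: "\<forall>M\<in>\<F>. \<epsilon> M > 0 \<and> (\<exists>v k r w w'. ?P M v k r w w' \<and> \<epsilon> M \<le> r ^ k)"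
    by (metis (no_types, lifting) bchoice)
  have "openin T (\<Union>\<F>)" using \<F>(2) power_chartD(3) unfolding \<U>_def by blast
  then obtain \<delta>1 where \<delta>1: "\<delta>1 > 0" "\<And>x. x \<in> topspace T \<Longrightarrow> f x \<in> Some ` ball a \<delta>1 \<Longrightarrow> x \<in> \<Union>\<F>"
    using fibre_neighbourhood[of "\<Union>\<F>" a] \<F>(3) unfolding K_def by blast
  define \<delta> where "\<delta> = Min (insert \<delta>1 (\<epsilon> ` \<F>)) / 2"
  have Mpos: "Min (insert \<delta>1 (\<epsilon> ` \<F>)) > 0" using \<F>(1) \<delta>1(1) \<epsilon> by simp
  then have pos: "\<delta> > 0" by (simp add: \<delta>_def)
  have le: "\<delta> < Min (insert \<delta>1 (\<epsilon> ` \<F>))" using Mpos by (simp add: \<delta>_def)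
  show ?thesis
  proof (rule that[OF pos])
    fix x assume x: "x \<in> topspace T" "f x \<in> Some ` ball a \<delta>"
    have "\<delta> < \<delta>1" using le \<F>(1) by simp
    then have "x \<in> \<Union>\<F>" using x by (intro \<delta>1(2)) auto
    then obtain M where M: "M \<in> \<F>" "x \<in> M" by blast
    then have "\<delta> < \<epsilon> M" using le \<F>(1) by simp
    then show "\<exists>v k r N w w'. power_chart a v k r N w w' \<and> x \<in> N \<and> \<delta> < r ^ k"
      using \<epsilon> M by (meson order_less_le_trans)
  qed
qed

text \<open>
  For small \<open>\<delta>\<close> the part of a power chart that lies over \<open>ball a \<delta>\<close> is open and closed in the preimage of that ball:
  by the power form it is cut out by \<open>norm (w y) < r\<close> as well as by \<open>norm (w y) \<le> \<rho>\<close> with \<open>\<rho> < r\<close>. Hence the connected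
  image of \<open>W \<inter> ball a \<delta>\<close> stays in the chart that it meets, and there \<open>norm (w y) ^ k\<close> is the distance of the value from \<open>a\<close>.
\<close>

lemma section_limit:
  assumes s: "section_on T f W s"
    and conn: "\<And>\<delta>. 0 < \<delta> \<Longrightarrow> \<delta> \<le> 1 \<Longrightarrow> connected (W \<inter> ball a \<delta>)"
    and ne: "\<And>\<delta>. 0 < \<delta> \<Longrightarrow> \<delta> \<le> 1 \<Longrightarrow> W \<inter> ball a \<delta> \<noteq> {}"
  obtains v where "v \<in> topspace T" "f v = Some a" "limitin T s v (at a within W)"
proof -
  have sT: "s z \<in> topspace T" "f (s z) = Some z" if "z \<in> W" for z
    using s that by (auto simp: section_on_def continuous_map_def Pi_iff)
  obtain \<delta>0 where \<delta>0: "0 < \<delta>0" "\<And>x. x \<in> topspace T \<Longrightarrow> f x \<in> Some ` ball a \<delta>0 \<Longrightarrow>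
     \<exists>v k r N w w'. power_chart a v k r N w w' \<and> x \<in> N \<and> \<delta>0 < r ^ k"
    using power_charts_cover_fibre by metis
  define \<delta> where "\<delta> = min \<delta>0 1"
  have \<delta>: "0 < \<delta>" "\<delta> \<le> 1" "\<delta> \<le> \<delta>0" using \<delta>0(1) by (auto simp: \<delta>_def)
  obtain z0 where z0: "z0 \<in> W" "z0 \<in> ball a \<delta>" using ne[OF \<delta>(1,2)] by auto
  then have "f (s z0) \<in> Some ` ball a \<delta>0" using sT \<delta>(3) by auto
  then obtain v k r N w w' where pc: "power_chart a v k r N w w'" and x: "s z0 \<in> N" and "\<delta>0 < r ^ k"
    using \<delta>0(2) sT z0 by meson
  then have \<delta>r: "\<delta> < r ^ k" using \<delta>(3) by simp
  note D = power_chartD[OF pc]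
  define C where "C = s ` (W \<inter> ball a \<delta>)"
  have CT: "connectedin T C"
    unfolding C_def
  proof (rule connectedin_continuous_map_image)
    show "continuous_map (top_of_set W) T s" using s by (simp add: section_on_def)
    show "connectedin (top_of_set W) (W \<inter> ball a \<delta>)"
      using conn[OF \<delta>(1,2)] by (simp add: connectedin_subtopology)
  qed
  have norm_w: "norm (w (s z)) ^ k = dist a z" if "z \<in> W" "s z \<in> N" for z
  proof -
    have "z = a + w (s z) ^ k" using sT(2) D(8) that by force
    then have "z - a = w (s z) ^ k" by (metis add_diff_cancel_left')
    then show ?thesis by (metis dist_commute dist_norm norm_power)
  qed
  \<comment> \<open>The radius over which the chart covers exactly \<open>ball a \<delta>\<close>.\<close>
  define \<rho> where "\<rho> = root k \<delta>"
  have \<rho>: "\<rho> ^ k = \<delta>" "0 < \<rho>" using D(1) \<delta>(1) by (auto simp: \<rho>_def)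
  then have \<rho>r: "\<rho> < r" using \<delta>r D(2) by (metis less_eq_real_def power_less_imp_less_base)
  have inM: "norm (w y) \<le> \<rho>" if y: "y \<in> C" "y \<in> N" for y
  proof -
    obtain z where z: "z \<in> W" "dist a z < \<delta>" "y = s z" using y(1) by (auto simp: C_def)
    then have "norm (w y) ^ k < \<rho> ^ k" using norm_w y(2) \<rho>(1) by simp
    then show ?thesis using \<rho>(2) by (metis less_eq_real_def power_less_imp_less_base)
  qed
  have sub: "C \<subseteq> N"
  proof (rule ccontr)
    assume "\<not> C \<subseteq> N"
    let ?M = "{y \<in> N. norm (w y) \<le> \<rho>}"
    have "openin T (topspace T - ?M)"
      using power_chart_closed_disc[OF pc \<rho>r] by (simp add: openin_diff)
    moreover have "C \<subseteq> N \<union> (topspace T - ?M)" "N \<inter> (topspace T - ?M) \<inter> C = {}"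
      using inM connectedin_subset_topspace[OF CT] by auto
    moreover have "N \<inter> C \<noteq> {}" using x z0 by (auto simp: C_def)
    moreover have "(topspace T - ?M) \<inter> C \<noteq> {}"
      using \<open>\<not> C \<subseteq> N\<close> connectedin_subset_topspace[OF CT] by auto
    ultimately show False using connectedinD[OF CT D(3)] by blast
  qed
  have "eventually (\<lambda>z. s z \<in> V) (at a within W)" if V: "openin T V" "v \<in> V" for V
  proof -
    obtain \<epsilon> where \<epsilon>: "0 < \<epsilon>" "\<And>y. y \<in> N \<Longrightarrow> norm (w y) < \<epsilon> \<Longrightarrow> y \<in> V"
      using power_chart_small_discs[OF pc V] by blast
    have "s z \<in> V" if z: "z \<in> W" "dist z a < min \<delta> (\<epsilon> ^ k)" for z
    proof -
      have N: "s z \<in> N" using sub z by (auto simp: C_def dist_commute)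
      then have "norm (w (s z)) ^ k < \<epsilon> ^ k" using norm_w z by (simp add: dist_commute)
      then have "norm (w (s z)) < \<epsilon>" using \<epsilon>(1) by (metis less_eq_real_def power_less_imp_less_base)
      then show ?thesis using \<epsilon>(2) N by blast
    qed
    moreover have "min \<delta> (\<epsilon> ^ k) > 0" using \<delta>(1) \<epsilon>(1) by simp
    ultimately show ?thesis unfolding eventually_at by blast
  qed
  then have "limitin T s v (at a within W)" using D(4,5) by (auto simp: limitin_def)
  then show ?thesis using that[of v] D(4,5,7) by blast
qed

text \<open>
  Near \<open>a\<close> all of the section is close to \<open>v\<close>, so a point over \<open>a\<close> other than \<open>v\<close> can be separated from it.
\<close>

lemma section_closure_unique:
  assumes s: "section_on T f W s" and lim: "limitin T s v (at a within W)" and a: "a \<notin> W"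
    and S: "S \<subseteq> W" and u: "u \<in> T closure_of (s ` S)" "f u = Some a"
  shows "u = v"
proof (rule ccontr)
  assume "u \<noteq> v"
  have uv: "u \<in> topspace T" "v \<in> topspace T"
    using u(1) lim by (auto simp: in_closure_of limitin_def)
  then obtain U V where UV: "openin T U" "openin T V" "u \<in> U" "v \<in> V" "disjnt U V"
    using Hausdorff \<open>u \<noteq> v\<close> unfolding Hausdorff_space_def by metis
  have "eventually (\<lambda>z. s z \<in> V) (at a within W)" using lim UV by (simp add: limitin_def)
  then obtain d where d: "d > 0" "\<And>z. z \<in> W \<Longrightarrow> z \<noteq> a \<Longrightarrow> dist z a < d \<Longrightarrow> s z \<in> V"
    unfolding eventually_at by blast
  let ?B = "{x \<in> topspace T. f x \<in> Some ` ball a d}"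
  have "openin T (U \<inter> ?B)" using UV(1) open_preimage[OF open_ball] by (intro openin_Int)
  moreover have "u \<in> U \<inter> ?B" using UV(3) uv u(2) d(1) by auto
  moreover have "\<forall>Z. u \<in> Z \<and> openin T Z \<longrightarrow> (\<exists>y. y \<in> s ` S \<and> y \<in> Z)"
    using u(1) unfolding in_closure_of by (rule conjunct2)
  ultimately have "\<exists>y. y \<in> s ` S \<and> y \<in> U \<inter> ?B" by presburger
  then obtain z where z: "z \<in> S" "s z \<in> U" "f (s z) \<in> Some ` ball a d" by auto
  then have "dist z a < d" using s S by (auto simp: section_on_def dist_commute)
  then have "s z \<in> V" using d(2) z(1) S a by blast
  then show False using z(2) UV(5) by (auto simp: disjnt_def)
qed

lemma section_limit_in_closure:
  fixes s :: "complex \<Rightarrow> 'a"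
  assumes lim: "limitin T s v (at a within W)" and S: "S \<subseteq> W" "a \<notin> S" "a \<in> closure S"
  shows "v \<in> T closure_of (s ` S)"
  unfolding in_closure_of
proof (intro conjI allI impI)
  show "v \<in> topspace T" using lim by (simp add: limitin_def)
  fix V assume "v \<in> V \<and> openin T V"
  then have "eventually (\<lambda>z. s z \<in> V) (at a within W)" using lim by (simp add: limitin_def)
  then obtain d where d: "d > 0" "\<And>z. z \<in> W \<Longrightarrow> z \<noteq> a \<Longrightarrow> dist z a < d \<Longrightarrow> s z \<in> V"
    unfolding eventually_at by blast
  obtain z where "z \<in> S" "dist z a < d" using S(3) d(1) closure_approachable by blast
  then show "\<exists>y. y \<in> s ` S \<and> y \<in> V" using d(2) S by blast
qed

end

section \<open>Dessins as coverings away from the branch points\<close>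

locale dessin_map = branched_map +
  assumes unramified: "\<And>x. x \<in> topspace T \<Longrightarrow> f x \<notin> {Some 0, Some 1, None} \<Longrightarrow>
    ramification_index X riemann_sphere f x = 1"
begin

lemma unramified_power_chart:
  assumes "power_chart a v k r N w w'" "a \<notin> {0, 1}"
  shows "k = 1"
  using unramified[of v] power_chartD[OF assms(1)] assms(2) by auto

text \<open>
  Over a value other than 0 and 1 the power charts have exponent 1, so they are sheets over small discs.
\<close>

sublocale cover: evenly_covering T f "- {0, 1}"
proof
  show "Hausdorff_space T" by (rule Hausdorff)
next
  fix x assume x: "x \<in> topspace T" "f x \<in> Some ` (- {0, 1})"
  then obtain a where a: "f x = Some a" "a \<notin> {0, 1}" by auto
  obtain U \<phi> where ch: "chart_at X x = (U, \<phi>)" by fastforce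
  obtain k r N w w' where pc: "power_chart a x k r N w w'"
    using power_chart_exists[OF x(1) a(1) ch, of 1] by (metis zero_less_one)
  note D = power_chartD[OF pc]
  have "inj_on f N"
  proof (rule inj_onI)
    fix y y' assume y: "y \<in> N" "y' \<in> N" "f y = f y'"
    then have "w y = w y'" using D(8) unramified_power_chart[OF pc a(2)] by force
    then show "y = y'" using D(10) y by metis
  qed
  then show "\<exists>N. openin T N \<and> x \<in> N \<and> inj_on f N" using D(3,5) by blast
next
  fix a :: complex assume "a \<in> - {0, 1}"
  then have a: "a \<notin> {0, 1}" by simp
  obtain \<delta> where \<delta>: "0 < \<delta>" "\<And>x. x \<in> topspace T \<Longrightarrow> f x \<in> Some ` ball a \<delta> \<Longrightarrow>
     \<exists>v k r N w w'. power_chart a v k r N w w' \<and> x \<in> N \<and> \<delta> < r ^ k"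
    using power_charts_cover_fibre by metis
  have "\<exists>s. section_on T f (ball a \<delta>) s \<and> s (the (f x)) = x"
    if x: "x \<in> topspace T" "f x \<in> Some ` ball a \<delta>" for x
  proof -
    obtain v k r N w w' where pc: "power_chart a v k r N w w'" "x \<in> N" "\<delta> < r ^ k"
      using \<delta>(2)[OF x] by blast
    note D = power_chartD[OF pc(1)]
    have k: "k = 1" using unramified_power_chart[OF pc(1) a] .
    have small: "norm (z - a) < r" if "z \<in> ball a \<delta>" for z
      using that pc(3) k by (simp add: dist_norm norm_minus_commute)
    have "continuous_map (top_of_set (ball a \<delta>)) (top_of_set (ball 0 r)) (\<lambda>z. z - a)"
      using small by (auto intro!: continuous_intros)
    then have "continuous_map (top_of_set (ball a \<delta>)) T (w' \<circ> (\<lambda>z. z - a))"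
      using D(14) by (rule continuous_map_compose)
    moreover have "f (w' (z - a)) = Some z" if "z \<in> ball a \<delta>" for z
      using D(8)[OF D(11)[OF small[OF that]]] D(12)[OF small[OF that]] k by simp
    ultimately have "section_on T f (ball a \<delta>) (\<lambda>z. w' (z - a))"
      by (simp add: section_on_def comp_def)
    moreover have "w' (the (f x) - a) = x" using D(8,10)[OF pc(2)] k by simp
    ultimately show ?thesis by blast
  qed
  then show "\<exists>\<delta>>0. \<forall>x\<in>topspace T. f x \<in> Some ` ball a \<delta> \<longrightarrow>
      (\<exists>s. section_on T f (ball a \<delta>) s \<and> s (the (f x)) = x)"
    using \<delta>(1) by blast
qed

end

lemma dessin_map_iff: "dessin_map X f \<longleftrightarrow> dessin X f"
  unfolding dessin_def dessin_map_def branched_map_def dessin_map_axioms_def by blast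

section \<open>Half-edges as sections over a slit plane\<close>

text \<open>
  The plane with the real axis removed except for the points of \<open>I\<close>. With an open interval \<open>I\<close> this is a
  star-shaped domain: two half planes joined through \<open>I\<close>. An interval between two consecutive points of
  0, 1 and infinity gives a simply connected domain that avoids the branch points.
\<close>

definition slit_domain :: "real set \<Rightarrow> complex set" where
  "slit_domain I = {z. Im z \<noteq> 0 \<or> Re z \<in> I}"

lemma open_slit_domain:
  assumes "open I"
  shows "open (slit_domain I)"
proof -
  have "slit_domain I = {z. Im z \<noteq> 0} \<union> Re -` I" by (auto simp: slit_domain_def)
  moreover have "open (Re -` I)" using assms by (intro open_vimage continuous_intros)
  ultimately show ?thesis by (auto intro!: open_Collect_neq continuous_intros)
qed

lemma starlike_slit_domain_Int:
  assumes I: "convex I" "c \<in> I" and B: "convex B" "complex_of_real c \<in> B"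
  shows "starlike (slit_domain I \<inter> B)"
  unfolding starlike_def
proof (intro bexI[of _ "complex_of_real c"] ballI)
  fix z assume z: "z \<in> slit_domain I \<inter> B"
  have "closed_segment (complex_of_real c) z \<subseteq> slit_domain I"
  proof
    fix y assume "y \<in> closed_segment (complex_of_real c) z"
    then obtain u where u: "0 \<le> u" "u \<le> 1" "y = (1 - u) *\<^sub>R complex_of_real c + u *\<^sub>R z"
      by (auto simp: in_segment)
    show "y \<in> slit_domain I"
    proof (cases "Im z = 0")
      case True
      then have "Re z \<in> I" using z by (simp add: slit_domain_def)
      then have "(1 - u) *\<^sub>R c + u *\<^sub>R Re z \<in> I" using I u by (intro convexD) auto
      then show ?thesis using u(3) by (simp add: slit_domain_def)
    next
      case False
      then show ?thesis using u I(2) by (cases "u = 0") (auto simp: slit_domain_def)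
    qed
  qed
  moreover have "closed_segment (complex_of_real c) z \<subseteq> B"
    using B z by (simp add: closed_segment_subset)
  ultimately show "closed_segment (complex_of_real c) z \<subseteq> slit_domain I \<inter> B" by blast
qed (use I B in \<open>auto simp: slit_domain_def\<close>)

lemma connected_slit_domain_Int:
  assumes "convex I" "c \<in> I" "convex B" "complex_of_real c \<in> B"
  shows "connected (slit_domain I \<inter> B)"
  using starlike_slit_domain_Int[OF assms] starlike_imp_connected by blast

lemma simply_connected_slit_domain:
  assumes "convex I" "I \<noteq> {}"
  shows "simply_connected (slit_domain I)"
proof -
  obtain c where "c \<in> I" using assms(2) by blast
  then have "starlike (slit_domain I \<inter> UNIV)" using assms(1) by (intro starlike_slit_domain_Int) auto
  then show ?thesis using starlike_imp_simply_connected by simp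
qed

abbreviation edge_domain :: "complex set" where "edge_domain \<equiv> slit_domain {0<..<1}"

definition open_edge :: "complex set" where "open_edge = complex_of_real ` {0<..<1}"

lemma open_edge_subset: "open_edge \<subseteq> edge_domain"
  by (auto simp: open_edge_def slit_domain_def)

lemma half_in_open_edge: "1 / 2 \<in> open_edge"
  unfolding open_edge_def by (rule image_eqI[of _ _ "1 / 2"]) auto

lemma connected_open_edge: "connected open_edge"
  unfolding open_edge_def by (intro connected_continuous_image continuous_intros) simp

lemma open_edge_accumulates:
  assumes "a = 0 \<or> a = 1"
  shows "a \<in> closure open_edge"
proof -
  have "complex_of_real ` closure {0<..<1} \<subseteq> closure open_edge"
    unfolding open_edge_def
    by (intro image_closure_subset closed_closure closure_subset continuous_intros)
  moreover have "a \<in> complex_of_real ` {0..1}"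
    using assms by (auto intro: image_eqI[of _ _ "0::real"] image_eqI[of _ _ "1::real"])
  ultimately show ?thesis by auto
qed

lemma edge_domain_near_end:
  assumes a: "a = 0 \<or> a = (1::complex)" and \<delta>: "0 < \<delta>" "\<delta> \<le> 1"
  shows "connected (edge_domain \<inter> ball a \<delta>)" "edge_domain \<inter> ball a \<delta> \<noteq> {}"
proof -
  \<comment> \<open>A centre for star-shapedness inside the ball; this is where \<open>\<delta> \<le> 1\<close> enters.\<close>
  have "\<exists>c. c \<in> {0<..<1} \<and> complex_of_real c \<in> ball a \<delta>"
    using a
  proof
    assume "a = 0"
    then show ?thesis using \<delta> by (intro exI[of _ "\<delta> / 2"]) auto
  next
    assume "a = 1"
    moreover have "dist (1::complex) (of_real (1 - \<delta> / 2)) = \<delta> / 2"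
      using \<delta> by (simp add: dist_norm)
    ultimately show ?thesis using \<delta> by (intro exI[of _ "1 - \<delta> / 2"]) auto
  qed
  then obtain c where c: "c \<in> {0<..<1}" "complex_of_real c \<in> ball a \<delta>" by blast
  then show "connected (edge_domain \<inter> ball a \<delta>)"
    by (intro connected_slit_domain_Int[of _ c]) auto
  have "complex_of_real c \<in> edge_domain \<inter> ball a \<delta>"
    using c by (auto simp: slit_domain_def)
  then show "edge_domain \<inter> ball a \<delta> \<noteq> {}" by blast
qed

context dessin_map
begin

lemma slit_section_exists:
  assumes I: "open I" "convex I" "I \<noteq> {}" "0 \<notin> I" "1 \<notin> I"
    and x: "x \<in> topspace T" "f x = Some z" "z \<in> slit_domain I"
  obtains s where "section_on T f (slit_domain I) s" "s z = x"
proof -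
  have "slit_domain I \<subseteq> - {0, 1}" using I(4,5) by (auto simp: slit_domain_def)
  from cover.section_exists[OF open_slit_domain[OF I(1)] simply_connected_slit_domain[OF I(2,3)] this x]
  show ?thesis using that by blast
qed

lemma slit_section_unique:
  assumes "section_on T f W s" "section_on T f W s'" "W = slit_domain I"
    "convex I" "I \<noteq> {}" "0 \<notin> I" "1 \<notin> I" "z0 \<in> W" "s z0 = s' z0" "z \<in> W"
  shows "s z = s' z"
proof (rule cover.section_unique[OF assms(1,2) _ _ assms(8,9,10)])
  show "W \<subseteq> - {0, 1}" using assms by (auto simp: slit_domain_def)
  obtain c where "c \<in> I" using assms(5) by blast
  then show "connected W" using connected_slit_domain_Int[of I c UNIV] assms(3,4) by simp
qed

definition half_edge_section :: "'a set \<Rightarrow> (complex \<Rightarrow> 'a) \<Rightarrow> bool" where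
  "half_edge_section h s \<longleftrightarrow> section_on T f edge_domain s \<and> s ` open_edge = h"

lemma section_onD:
  assumes "section_on T f W s" "z \<in> W"
  shows "s z \<in> topspace T" "f (s z) = Some z"
  using assms by (auto simp: section_on_def continuous_map_def Pi_iff)

text \<open>
  The maps \<open>s \<circ> the \<circ> f\<close> and the identity are two lifts of \<open>f\<close> on the component, and they agree at \<open>s z\<close>.
\<close>

lemma section_image_component:
  assumes s: "section_on T f edge_domain s" and z: "z \<in> open_edge"
  shows "connected_component_of_set (subtopology T {x. \<exists>t::real. 0 < t \<and> t < 1 \<and> f x = Some (of_real t)}) (s z)
     = s ` open_edge"
proof -
  define E where "E = {x. \<exists>t::real. 0 < t \<and> t < 1 \<and> f x = Some (of_real t)}"
  have E: "x \<in> E \<longleftrightarrow> f x \<in> Some ` open_edge" for x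
    by (auto simp: E_def open_edge_def)
  have "connectedin T (s ` open_edge)"
  proof (rule connectedin_continuous_map_image)
    show "continuous_map (top_of_set edge_domain) T s" using s by (simp add: section_on_def)
    show "connectedin (top_of_set edge_domain) open_edge"
      using open_edge_subset connected_open_edge by (simp add: connectedin_subtopology)
  qed
  moreover have sE: "s ` open_edge \<subseteq> E"
    using section_onD(2)[OF s] open_edge_subset by (auto simp: E)
  ultimately have conn: "connectedin (subtopology T E) (s ` open_edge)"
    by (simp add: connectedin_subtopology)
  have "y \<in> s ` open_edge" if y: "connected_component_of (subtopology T E) (s z) y" for y
  proof -
    obtain C where C: "connectedin (subtopology T E) C" "s z \<in> C" "y \<in> C"
      using y by (auto simp: connected_component_of_def)
    then have CT: "connectedin T C" "C \<subseteq> E" by (auto simp: connectedin_subtopology)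
    then have Csub: "C \<subseteq> topspace T" using connectedin_subset_topspace by blast
    have fC: "f x = Some (the (f x))" "the (f x) \<in> open_edge" if "x \<in> C" for x
      using that CT(2) E by force+
    have "continuous_map (subtopology T C) (top_of_set edge_domain) (the \<circ> f)"
    proof -
      have "openin (subtopology T C) {x \<in> C. the (f x) \<in> V}" if "open V" for V
      proof -
        have "{x \<in> C. the (f x) \<in> V} = C \<inter> {x \<in> topspace T. f x \<in> Some ` V}"
          using Csub fC(1) by (auto simp: image_iff)
        then show ?thesis using open_preimage[OF that] by (simp add: openin_subtopology_Int2)
      qed
      moreover have "topspace (subtopology T C) = C" using Csub by auto
      ultimately have "continuous_map (subtopology T C) euclidean (the \<circ> f)"
        by (simp add: continuous_map_def)
      then show ?thesis
        using fC(2) open_edge_subset Csub by (auto simp: continuous_map_in_subtopology)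
    qed
    then have c1: "continuous_map (subtopology T C) T (s \<circ> (the \<circ> f))"
      using s unfolding section_on_def by (metis continuous_map_compose)
    have fs: "f (s (the (f x))) = f x" if "x \<in> C" for x
      using section_onD(2)[OF s] fC[OF that] open_edge_subset by (metis subsetD)
    have "(s \<circ> (the \<circ> f)) y = id y"
    proof (rule lifts_agree[OF Hausdorff _ c1, of id f "s z"])
      show "connected_space (subtopology T C)" using CT(1) by (simp add: connectedin_def)
      show "continuous_map (subtopology T C) T id" by (simp add: continuous_map_from_subtopology)
      show "(s \<circ> (the \<circ> f)) (s z) = id (s z)"
        using section_onD(2)[OF s] z open_edge_subset by auto
      fix x assume x: "x \<in> topspace (subtopology T C)"
      then show "f ((s \<circ> (the \<circ> f)) x) = f (id x)" using fs by simp
      have xC: "x \<in> C" using x by simp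
      then have "the (f x) \<in> edge_domain" using fC(2) open_edge_subset by blast
      then have "s (the (f x)) \<in> topspace T" "the (f x) \<in> - {0, 1}"
        using section_onD(1)[OF s] by (auto simp: slit_domain_def)
      moreover from this(2) have "f (s (the (f x))) \<in> Some ` (- {0, 1})"
        using fs[OF xC] fC(1)[OF xC] by (metis imageI)
      ultimately show "\<exists>N. openin T N \<and> (s \<circ> (the \<circ> f)) x \<in> N \<and> inj_on f N"
        using cover.locally_inj by simp
    qed (use C Csub in auto)
    then have "y = s (the (f y))" by simp
    then show ?thesis using fC(2)[OF C(3)] by blast
  qed
  moreover have "connected_component_of (subtopology T E) (s z) y" if "y \<in> s ` open_edge" for y
    using conn z that unfolding connected_component_of_def by blast
  ultimately show ?thesis unfolding E_def by blast
qed

lemma section_image_half_edge: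
  assumes s: "section_on T f edge_domain s"
  shows "s ` open_edge \<in> half_edges X f"
proof -
  let ?Y = "subtopology T {x. \<exists>t::real. 0 < t \<and> t < 1 \<and> f x = Some (of_real t)}"
  let ?z = "1 / 2 :: complex"
  have z: "?z \<in> edge_domain" using half_in_open_edge open_edge_subset by blast
  have "f (s ?z) = Some (of_real (1 / 2))" using section_onD(2)[OF s z] by simp
  then have "s ?z \<in> topspace ?Y"
    using section_onD(1)[OF s z] by (auto intro!: exI[of _ "1 / 2 :: real"])
  then show ?thesis
    unfolding half_edges_def connected_components_of_def
    using section_image_component[OF s half_in_open_edge] by blast
qed

lemma half_edge_section_exists:
  assumes "h \<in> half_edges X f"
  obtains s where "half_edge_section h s"
proof -
  let ?Y = "subtopology T {x. \<exists>t::real. 0 < t \<and> t < 1 \<and> f x = Some (of_real t)}"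
  obtain x where x: "x \<in> topspace ?Y" "h = connected_component_of_set ?Y x"
    using assms unfolding half_edges_def connected_components_of_def by blast
  then obtain t :: real where t: "0 < t" "t < 1" "f x = Some (of_real t)" "x \<in> topspace T" by auto
  then have z: "of_real t \<in> open_edge" by (auto simp: open_edge_def)
  obtain s where s: "section_on T f edge_domain s" "s (of_real t) = x"
    using slit_section_exists[OF _ _ _ _ _ t(4,3) subsetD[OF open_edge_subset z]] by auto
  then show ?thesis
    using that[of s] section_image_component[OF s(1) z] x(2) by (simp add: half_edge_section_def)
qed

text \<open>
  The half-edge \<open>h\<close> parametrised by its \<open>f\<close>-values, extended to both half planes. The values over the upper and
  lower half plane single out the two triangles that border on \<open>h\<close>.
\<close>

definition edge_section :: "'a set \<Rightarrow> complex \<Rightarrow> 'a" where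
  "edge_section h = (SOME s. half_edge_section h s)"

lemma edge_section:
  assumes "h \<in> half_edges X f"
  shows "section_on T f edge_domain (edge_section h)" "edge_section h ` open_edge = h"
proof -
  have "half_edge_section h (edge_section h)"
    unfolding edge_section_def using half_edge_section_exists[OF assms] by (metis someI_ex)
  then show "section_on T f edge_domain (edge_section h)" "edge_section h ` open_edge = h"
    by (simp_all add: half_edge_section_def)
qed

lemma edge_domain_section_unique:
  assumes "section_on T f edge_domain s" "section_on T f edge_domain s'"
    "z0 \<in> edge_domain" "s z0 = s' z0" "z \<in> edge_domain"
  shows "s z = s' z"
  by (rule slit_section_unique[OF assms(1,2) refl _ _ _ _ assms(3-5)]) auto

lemma edge_section_eqI:
  assumes s: "section_on T f edge_domain s" and z: "z \<in> edge_domain"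
  shows "edge_section (s ` open_edge) z = s z"
proof -
  note h = edge_section[OF section_image_half_edge[OF s]]
  have half: "1 / 2 \<in> edge_domain" using half_in_open_edge open_edge_subset by blast
  have "s (1 / 2) \<in> edge_section (s ` open_edge) ` open_edge" using h(2) half_in_open_edge by blast
  then obtain w where w: "w \<in> open_edge" "s (1 / 2) = edge_section (s ` open_edge) w" by blast
  then have "w = 1 / 2" using section_onD(2)[OF s half] section_onD(2)[OF h(1), of w] open_edge_subset by auto
  then have "edge_section (s ` open_edge) (1 / 2) = s (1 / 2)" using w(2) by metis
  then show ?thesis by (rule edge_domain_section_unique[OF h(1) s half _ z])
qed

lemma half_edge_through:
  assumes "x \<in> topspace T" "f x = Some z" "z \<in> edge_domain"
  obtains h where "h \<in> half_edges X f" "edge_section h z = x"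
proof -
  obtain s where s: "section_on T f edge_domain s" "s z = x"
    using slit_section_exists[OF _ _ _ _ _ assms] by auto
  then show ?thesis
    using that[OF section_image_half_edge[OF s(1)]] edge_section_eqI[OF s(1) assms(3)] by simp
qed

lemma edge_section_inject:
  assumes "h \<in> half_edges X f" "h' \<in> half_edges X f" "z \<in> edge_domain"
    and eq: "edge_section h z = edge_section h' z"
  shows "h = h'"
proof -
  have "edge_section h w = edge_section h' w" if "w \<in> open_edge" for w
    using edge_domain_section_unique[OF edge_section(1)[OF assms(1)] edge_section(1)[OF assms(2)] assms(3) eq]
      that open_edge_subset by blast
  then have "edge_section h ` open_edge = edge_section h' ` open_edge" by simp
  then show ?thesis using edge_section(2) assms(1,2) by simp
qed

lemma half_edge_end:
  assumes h: "h \<in> half_edges X f" and a: "a = 0 \<or> a = (1::complex)"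
  obtains v where "v \<in> topspace T" "f v = Some a" "h \<in> half_edges_at X f v"
    "limitin T (edge_section h) v (at a within edge_domain)"
    "\<forall>u. f u = Some a \<and> h \<in> half_edges_at X f u \<longrightarrow> u = v"
proof -
  note s = edge_section[OF h]
  obtain v where v: "v \<in> topspace T" "f v = Some a" "limitin T (edge_section h) v (at a within edge_domain)"
    using section_limit[OF s(1) edge_domain_near_end[OF a]] by blast
  have aW: "a \<notin> edge_domain" using a by (auto simp: slit_domain_def)
  then have "v \<in> T closure_of (edge_section h ` open_edge)"
    using open_edge_subset open_edge_accumulates[OF a]
    by (intro section_limit_in_closure[OF v(3)]) auto
  then have "h \<in> half_edges_at X f v" using s(2) h by (simp add: half_edges_at_def)
  moreover have "u = v" if "f u = Some a" "h \<in> half_edges_at X f u" for u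
    using section_closure_unique[OF s(1) v(3) aW open_edge_subset _ that(1)] that(2) s(2)
    by (simp add: half_edges_at_def)
  ultimately show ?thesis using that v by blast
qed

lemma white_end:
  assumes "h \<in> half_edges X f"
  shows "white_end X f h \<in> white_vertices X f"
    "limitin T (edge_section h) (white_end X f h) (at 1 within edge_domain)"
proof -
  obtain v where v: "v \<in> topspace T" "f v = Some 1" "h \<in> half_edges_at X f v"
    "limitin T (edge_section h) v (at 1 within edge_domain)"
    "\<forall>u. f u = Some 1 \<and> h \<in> half_edges_at X f u \<longrightarrow> u = v"
    using half_edge_end[OF assms, of 1 thesis] by blast
  have e: "white_end X f h = v"
    unfolding white_end_def white_vertices_def by (rule the_equality) (use v in blast)+
  then show "white_end X f h \<in> white_vertices X f"
    "limitin T (edge_section h) (white_end X f h) (at 1 within edge_domain)"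
    using v unfolding e white_vertices_def by blast+
qed

lemma black_end:
  assumes "h \<in> half_edges X f"
  shows "black_end X f h \<in> black_vertices X f" "h \<in> half_edges_at X f (black_end X f h)"
    "\<And>u. f u = Some 0 \<Longrightarrow> h \<in> half_edges_at X f u \<Longrightarrow> black_end X f h = u"
proof -
  obtain v where v: "v \<in> topspace T" "f v = Some 0" "h \<in> half_edges_at X f v"
    "\<forall>u. f u = Some 0 \<and> h \<in> half_edges_at X f u \<longrightarrow> u = v"
    using half_edge_end[OF assms, of 0 thesis] by blast
  have e: "black_end X f h = v"
    unfolding black_end_def black_vertices_def by (rule the_equality) (use v in blast)+
  then show "black_end X f h \<in> black_vertices X f" "h \<in> half_edges_at X f (black_end X f h)"
    "\<And>u. f u = Some 0 \<Longrightarrow> h \<in> half_edges_at X f u \<Longrightarrow> black_end X f h = u"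
    using v unfolding e black_vertices_def by blast+
qed

end

section \<open>The rotation at a black vertex\<close>

abbreviation gap_domain :: "complex set" where "gap_domain \<equiv> slit_domain {..<0}"

lemma edge_domain_not_nonpos: "z \<in> edge_domain \<Longrightarrow> z \<notin> \<real>\<^sub>\<le>\<^sub>0"
  by (auto simp: slit_domain_def complex_nonpos_Reals_iff)

lemma gap_domain_not_nonneg: "z \<in> gap_domain \<Longrightarrow> - z \<notin> \<real>\<^sub>\<le>\<^sub>0"
  by (auto simp: slit_domain_def complex_nonpos_Reals_iff)

text \<open>
  Branches of the \<open>k\<close>-th root, cut along the negative and along the positive real axis respectively. The branch
  \<open>j\<close> is the one whose argument at positive reals is \<open>2 * pi * j / k\<close>. The second family has
  argument between \<open>2 * pi * j / k\<close> and \<open>2 * pi * (j + 1) / k\<close>, so it connects the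
  branches \<open>j\<close> and \<open>j + 1\<close> of the first.
\<close>

definition root_branch :: "nat \<Rightarrow> int \<Rightarrow> complex \<Rightarrow> complex" where
  "root_branch k j z = exp ((Ln z + of_int (2 * j) * of_real pi * \<i>) / of_nat k)"

definition gap_root_branch :: "nat \<Rightarrow> int \<Rightarrow> complex \<Rightarrow> complex" where
  "gap_root_branch k j z = exp ((Ln (- z) + of_int (2 * j + 1) * of_real pi * \<i>) / of_nat k)"

lemma exp_2pi_int: "exp (of_int (2 * j) * of_real pi * \<i>) = (1::complex)"
  using exp_integer_2pi[of "of_int j"] by (simp add: algebra_simps)

lemma exp_2pi_int_plus1: "exp (of_int (2 * j + 1) * of_real pi * \<i>) = (-1::complex)"
  using exp_integer_2pi_plus1[of "of_int j"] by (simp add: algebra_simps)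

lemma root_branch_power:
  assumes "0 < k" "z \<noteq> 0"
  shows "root_branch k j z ^ k = z"
proof -
  have "root_branch k j z ^ k = exp (Ln z + of_int (2 * j) * of_real pi * \<i>)"
    using assms by (simp add: root_branch_def flip: exp_of_nat_mult)
  then show ?thesis using assms by (simp add: exp_add exp_2pi_int del: of_int_mult)
qed

lemma gap_root_branch_power:
  assumes "0 < k" "z \<noteq> 0"
  shows "gap_root_branch k j z ^ k = z"
proof -
  have "gap_root_branch k j z ^ k = exp (Ln (- z) + of_int (2 * j + 1) * of_real pi * \<i>)"
    using assms by (simp add: gap_root_branch_def flip: exp_of_nat_mult)
  then show ?thesis using assms by (simp add: exp_add exp_2pi_int_plus1 del: of_int_mult of_int_add)
qed

lemma gap_root_branch_upper:
  assumes "Im z > 0"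
  shows "gap_root_branch k j z = root_branch k j z"
proof -
  have "Ln (- z) = Ln z - \<i> * pi" using assms by (subst Ln_minus) auto
  then have "Ln (- z) + of_int (2 * j + 1) * of_real pi * \<i> = Ln z + of_int (2 * j) * of_real pi * \<i>"
    by (simp add: algebra_simps)
  then show ?thesis by (simp only: gap_root_branch_def root_branch_def)
qed

lemma gap_root_branch_lower:
  assumes "Im z < 0"
  shows "gap_root_branch k j z = root_branch k (j + 1) z"
proof -
  have "Ln (- z) = Ln z + \<i> * pi" using assms by (subst Ln_minus) auto
  then have "Ln (- z) + of_int (2 * j + 1) * of_real pi * \<i> = Ln z + of_int (2 * (j + 1)) * of_real pi * \<i>"
    by (simp add: algebra_simps)
  then show ?thesis by (simp only: gap_root_branch_def root_branch_def)
qed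

lemma root_branch_mod:
  assumes "0 < k"
  shows "root_branch k (j + m * int k) z = root_branch k j z"
proof -
  have "(Ln z + of_int (2 * (j + m * int k)) * of_real pi * \<i>) / of_nat k
      = (Ln z + of_int (2 * j) * of_real pi * \<i>) / of_nat k + of_int (2 * m) * of_real pi * \<i>"
    using assms by (simp add: field_simps)
  then show ?thesis by (simp add: root_branch_def exp_add exp_2pi_int del: of_int_mult of_int_add)
qed

lemma power_eq_imp_root_branch:
  assumes "0 < k" "w ^ k = z" "z \<noteq> 0"
  obtains j where "w = root_branch k j z"
proof -
  have w: "w \<noteq> 0" using assms by auto
  then have "exp (of_nat k * Ln w) = exp (Ln z)" using assms by (simp add: exp_of_nat_mult)
  then obtain j :: int where "of_nat k * Ln w = Ln z + (of_int (2 * j) * of_real pi) * \<i>"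
    unfolding exp_eq by auto
  then have "Ln w = (Ln z + of_int (2 * j) * of_real pi * \<i>) / of_nat k"
    using assms(1) by (simp add: field_simps)
  then have "w = root_branch k j z" using w by (metis exp_Ln root_branch_def)
  then show ?thesis using that by blast
qed

lemma root_branch_of_real:
  assumes "0 < t"
  shows "root_branch k j (of_real t) = of_real (exp (ln t / k)) * cis (2 * pi * j / k)"
proof -
  have "root_branch k j (of_real t) = exp (of_real (ln t / k) + \<i> * of_real (2 * pi * j / k))"
    unfolding root_branch_def using assms by (intro arg_cong[of _ _ exp]) (simp add: Ln_of_real add_divide_distrib mult_ac)
  then show ?thesis unfolding exp_add exp_of_real cis_conv_exp .
qed

lemma sgn_root_branch:
  assumes "0 < t"
  shows "sgn (root_branch k j (of_real t)) = cis (2 * pi * j / k)"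
  using assms by (simp add: root_branch_of_real sgn_mult sgn_of_real)

text \<open>
  Shifting by \<open>m = k\<close> returns to the start and is counted as a full turn, in agreement with the convention
  for the angle from a direction to itself.
\<close>

lemma ccw_angle_cis:
  assumes k: "0 < k" and m: "1 \<le> m" "m \<le> int k" and u: "u \<noteq> 0"
  shows "ccw_angle (cis (2 * pi * i / k) * u) (cis (2 * pi * real_of_int (i + m) / k) * u) = 2 * pi * m / k"
proof -
  have "2 * pi * real_of_int (i + m) / k = 2 * pi * i / k + 2 * pi * m / k"
    unfolding of_int_add distrib_left add_divide_distrib ..
  then have ratio: "(cis (2 * pi * real_of_int (i + m) / k) * u) / (cis (2 * pi * i / k) * u) = cis (2 * pi * m / k)"
    using u by (simp add: cis_divide)
  show ?thesis
  proof (cases "m = int k")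
    case True
    have "Arg2pi 1 = 0" by (rule Arg2pi_unique[of 1]) auto
    then show ?thesis using k True unfolding ccw_angle_def ratio by simp
  next
    case False
    then have "real_of_int m < real k" using m(2) by linarith
    then have "2 * pi * m / k < 2 * pi" using k by (simp add: field_simps)
    then have "Arg2pi (cis (2 * pi * m / k)) = 2 * pi * m / k"
      using m k by (intro Arg2pi_unique[of 1]) (auto simp: cis_conv_exp)
    then show ?thesis using m k unfolding ccw_angle_def ratio by simp
  qed
qed

text \<open>
  A power chart at a black vertex together with its relation \<open>w y = (\<phi> y - \<phi> v) * g (\<phi> y)\<close> to the
  chart \<open>\<phi>\<close> in which directions are read. The bound \<open>r \<le> 1\<close> keeps \<open>f\<close> off the value 1.
\<close>

locale black_vertex_chart = dessin_map +
  fixes v :: 'a and U :: "'a set" and \<phi> :: "'a \<Rightarrow> complex"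
    and k :: nat and r :: real and N :: "'a set" and w :: "'a \<Rightarrow> complex"
    and w' :: "complex \<Rightarrow> 'a" and g :: "complex \<Rightarrow> complex"
  assumes chart: "chart_at X v = (U, \<phi>)" and pc: "power_chart 0 v k r N w w'"
    and r1: "r \<le> 1" and NU: "N \<subseteq> U"
    and w_eq: "\<And>y. y \<in> N \<Longrightarrow> w y = (\<phi> y - \<phi> v) * g (\<phi> y)"
    and g_cont: "isCont g (\<phi> v)" and g_nz: "\<And>y. y \<in> N \<Longrightarrow> g (\<phi> y) \<noteq> 0"
begin

lemmas pcD = power_chartD[OF pc]

definition \<rho> where "\<rho> = r ^ k"

lemma rho: "0 < \<rho>" "\<rho> \<le> 1"
  using pcD(1,2) r1 by (auto simp: \<rho>_def power_le_one)

lemma norm_less_of_power: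
  fixes z y :: complex
  assumes "z ^ k = y" "norm y < \<rho>"
  shows "norm z < r"
proof (rule power_less_imp_less_base)
  have "norm z ^ k = norm y" using assms(1) norm_power[of z k] by simp
  then show "norm z ^ k < r ^ k" using assms(2) by (simp add: \<rho>_def)
qed (use pcD(2) in simp)

lemma root_branch_section:
  assumes W: "W \<subseteq> ball 0 \<rho> - {0}" and cont: "continuous_on W b" and pow: "\<And>z. z \<in> W \<Longrightarrow> b z ^ k = z"
  shows "section_on T f W (\<lambda>z. w' (b z))"
proof -
  have small: "norm (b z) < r" if "z \<in> W" for z
    using norm_less_of_power[OF pow[OF that]] W that by auto
  then have "continuous_map (top_of_set W) (top_of_set (ball 0 r)) b"
    using cont by auto
  then have "continuous_map (top_of_set W) T (w' \<circ> b)" using pcD(14) by (rule continuous_map_compose)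
  moreover have "f (w' (b z)) = Some z" if "z \<in> W" for z
    using pcD(8)[OF pcD(11)[OF small[OF that]]] pcD(12)[OF small[OF that]] pow[OF that] by simp
  ultimately show ?thesis by (simp add: section_on_def comp_def)
qed

definition sector :: "int \<Rightarrow> complex \<Rightarrow> 'a" where
  "sector j z = w' (root_branch k j z)"

lemma sector_section: "section_on T f (edge_domain \<inter> ball 0 \<rho>) (sector j)"
  unfolding sector_def
proof (rule root_branch_section)
  show "edge_domain \<inter> ball 0 \<rho> \<subseteq> ball 0 \<rho> - {0}" by (auto simp: slit_domain_def)
  show "continuous_on (edge_domain \<inter> ball 0 \<rho>) (root_branch k j)"
    unfolding root_branch_def using pcD(1) edge_domain_not_nonpos by (intro continuous_intros) auto
  show "root_branch k j z ^ k = z" if "z \<in> edge_domain \<inter> ball 0 \<rho>" for z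
    using that pcD(1) by (intro root_branch_power) (auto simp: slit_domain_def)
qed

lemma gap_sector_section: "section_on T f (gap_domain \<inter> ball 0 \<rho>) (\<lambda>z. w' (gap_root_branch k j z))"
proof (rule root_branch_section)
  show "gap_domain \<inter> ball 0 \<rho> \<subseteq> ball 0 \<rho> - {0}" by (auto simp: slit_domain_def)
  show "continuous_on (gap_domain \<inter> ball 0 \<rho>) (gap_root_branch k j)"
    unfolding gap_root_branch_def using pcD(1) gap_domain_not_nonneg by (intro continuous_intros) auto
  show "gap_root_branch k j z ^ k = z" if "z \<in> gap_domain \<inter> ball 0 \<rho>" for z
    using that pcD(1) by (intro gap_root_branch_power) (auto simp: slit_domain_def)
qed

lemma real_in_sector_domain:
  assumes "0 < t" "t < \<rho>"
  shows "complex_of_real t \<in> edge_domain \<inter> ball 0 \<rho>" "complex_of_real t \<in> open_edge"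
  using assms rho by (auto simp: slit_domain_def open_edge_def)

lemma ray_exists: "\<exists>h\<in>half_edges X f. \<forall>z\<in>edge_domain \<inter> ball 0 \<rho>. edge_section h z = sector j z"
proof -
  let ?D = "edge_domain \<inter> ball 0 \<rho>"
  have z0: "complex_of_real (\<rho> / 2) \<in> ?D" using rho by (intro real_in_sector_domain) auto
  obtain h where h: "h \<in> half_edges X f" "edge_section h (of_real (\<rho> / 2)) = sector j (of_real (\<rho> / 2))"
    using half_edge_through[OF section_onD[OF sector_section z0]] z0 by blast
  have hs: "section_on T f ?D (edge_section h)"
    using edge_section(1)[OF h(1)] by (auto simp: section_on_def intro: continuous_map_from_subtopology_mono)
  have "edge_section h z = sector j z" if "z \<in> ?D" for z
  proof (rule cover.section_unique[OF hs sector_section _ _ z0 h(2) that])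
    show "connected ?D" using edge_domain_near_end(1)[of 0] rho by simp
  qed (auto simp: slit_domain_def)
  then show ?thesis using h(1) by blast
qed

text \<open>
  The half-edge that leaves the vertex at argument \<open>2 * pi * j / k\<close> in the coordinate \<open>w\<close>. Integer
  indices, periodic with period \<open>k\<close>, spare reductions modulo \<open>k\<close>.
\<close>

definition ray :: "int \<Rightarrow> 'a set" where
  "ray j = (SOME h. h \<in> half_edges X f \<and> (\<forall>z\<in>edge_domain \<inter> ball 0 \<rho>. edge_section h z = sector j z))"

lemma ray: "ray j \<in> half_edges X f" "z \<in> edge_domain \<inter> ball 0 \<rho> \<Longrightarrow> edge_section (ray j) z = sector j z"
proof -
  have "ray j \<in> half_edges X f \<and> (\<forall>z\<in>edge_domain \<inter> ball 0 \<rho>. edge_section (ray j) z = sector j z)"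
    unfolding ray_def by (rule someI_ex) (use ray_exists in blast)
  then show "ray j \<in> half_edges X f" "z \<in> edge_domain \<inter> ball 0 \<rho> \<Longrightarrow> edge_section (ray j) z = sector j z"
    by blast+
qed

lemma ray_mod: "ray (j + m * int k) = ray j"
  using root_branch_mod[OF pcD(1), of j m] by (simp add: ray_def sector_def)

lemma ray_eqI:
  assumes "h \<in> half_edges X f" "z \<in> edge_domain \<inter> ball 0 \<rho>" "edge_section h z = sector j z"
  shows "h = ray j"
  by (rule edge_section_inject[OF assms(1) ray(1)]) (use assms ray(2) in auto)

lemma half_edge_in_chart:
  assumes h: "h \<in> half_edges X f" and y: "y \<in> h" "y \<in> N"
  obtains j t where "h = ray j" "0 < t" "w y = root_branch k j (of_real t)"
proof -
  have "y \<in> edge_section h ` open_edge" using edge_section(2)[OF h] y(1) by simp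
  then obtain t where t: "0 < t" "t < 1" "y = edge_section h (of_real t)"
    by (auto simp: open_edge_def)
  then have "complex_of_real t \<in> open_edge" by (auto simp: open_edge_def)
  then have "f y = Some (of_real t)"
    using section_onD(2)[OF edge_section(1)[OF h]] open_edge_subset t(3) by blast
  then have pow: "w y ^ k = of_real t" using pcD(8)[OF y(2)] by simp
  obtain j where j: "w y = root_branch k j (of_real t)"
    using power_eq_imp_root_branch[OF pcD(1) pow] t(1) by auto
  have "norm (w y) ^ k < r ^ k"
    using pcD(1) pcD(9)[OF y(2)] by (intro power_strict_mono) auto
  then have "t < \<rho>" using pow t(1) by (metis \<rho>_def abs_of_pos norm_of_real norm_power)
  then have "h = ray j"
    using t j pcD(10)[OF y(2)] by (intro ray_eqI[OF h, of "of_real t"] real_in_sector_domain) (auto simp: sector_def)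
  then show ?thesis using that t(1) j by blast
qed

lemma sector_real:
  assumes "0 < t" "t < \<rho>"
  shows "sector j (of_real t) \<in> N" "w (sector j (of_real t)) = root_branch k j (of_real t)"
    "sector j (of_real t) \<in> ray j"
proof -
  have "norm (root_branch k j (of_real t)) < r"
    using assms root_branch_power[OF pcD(1), of "of_real t" j]
    by (intro norm_less_of_power) auto
  then show "sector j (of_real t) \<in> N" "w (sector j (of_real t)) = root_branch k j (of_real t)"
    using pcD(11,12) by (simp_all add: sector_def)
  show "sector j (of_real t) \<in> ray j"
    using imageI[OF real_in_sector_domain(2)[OF assms], of "edge_section (ray j)"]
    unfolding ray(2)[OF real_in_sector_domain(1)[OF assms]] edge_section(2)[OF ray(1)] .
qed

text \<open>
  Half-edges are images of sections, so \<open>f\<close> is injective on each of them: the coordinates of equal rays at the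
  same value \<open>\<rho> / 2\<close> coincide, and their arguments differ by \<open>2 * pi / k\<close>.
\<close>

lemma ray_inject_step:
  assumes "ray (j + 1) = ray j"
  shows "k = 1"
proof -
  let ?t = "\<rho> / 2"
  have t: "0 < ?t" "?t < \<rho>" using rho by auto
  have "sector (j + 1) (of_real ?t) = sector j (of_real ?t)"
    using ray(2)[of "of_real ?t"] real_in_sector_domain[OF t] assms by metis
  then have "root_branch k (j + 1) (of_real ?t) = root_branch k j (of_real ?t)"
    using sector_real(2)[OF t] by metis
  then have "cis (2 * pi * real_of_int (j + 1) / k) = cis (2 * pi * j / k)"
    using sgn_root_branch[OF t(1)] by metis
  moreover have "2 * pi * real_of_int (j + 1) / k = 2 * pi * j / k + 2 * pi / k"
    by (simp add: distrib_left add_divide_distrib)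
  ultimately have "cis (2 * pi / k) = 1"
    by (metis cis_mult cis_neq_zero mult_cancel_left1 mult.right_neutral)
  then have "cos (2 * pi / k) = 1" by (metis cis.sel(1) one_complex.sel(1))
  then obtain n :: int where "2 * pi / k = of_int n * 2 * pi"
    unfolding cos_one_2pi_int by blast
  then have "1 = real_of_int n * real k" using pcD(1) by (simp add: field_simps)
  then have "1 = n * int k" by (metis of_int_1 of_int_eq_iff of_int_mult of_int_of_nat_eq)
  then have "int k dvd 1" by (metis dvd_triv_right)
  then show ?thesis by simp
qed

lemma sector_near_vertex:
  assumes V: "openin T V" "v \<in> V"
  obtains y where "y \<in> ray j" "y \<in> V" "y \<noteq> v"
proof -
  obtain \<epsilon> where \<epsilon>: "0 < \<epsilon>" "\<And>y. y \<in> N \<Longrightarrow> norm (w y) < \<epsilon> \<Longrightarrow> y \<in> V"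
    using power_chart_small_discs[OF pc V] by blast
  define t where "t = min \<rho> (\<epsilon> ^ k) / 2"
  have t: "0 < t" "t < \<rho>" "t < \<epsilon> ^ k"
    using rho(1) \<epsilon>(1) zero_less_power[OF \<epsilon>(1), of k] by (auto simp: t_def min_def)
  note S = sector_real[OF t(1,2), of j]
  have "root_branch k j (of_real t) ^ k = of_real t"
    using root_branch_power[OF pcD(1)] t(1) by simp
  then have "norm (root_branch k j (of_real t)) ^ k < \<epsilon> ^ k"
    using t(1,3) by (simp flip: norm_power)
  then have "norm (w (sector j (of_real t))) < \<epsilon>"
    unfolding S(2) by (rule power_less_imp_less_base) (use \<epsilon>(1) in simp)
  then have "sector j (of_real t) \<in> V" using \<epsilon>(2) S(1) by blast
  moreover have "w (sector j (of_real t)) \<noteq> 0" using S(2) by (simp add: root_branch_def)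
  then have "sector j (of_real t) \<noteq> v" using pcD(6) by metis
  ultimately show ?thesis using that S(3) by blast
qed

lemma half_edges_at_vertex: "half_edges_at X f v = range ray"
proof (intro equalityI subsetI)
  fix h assume "h \<in> half_edges_at X f v"
  then have h: "h \<in> half_edges X f" and cl: "v \<in> T closure_of h" by (auto simp: half_edges_at_def)
  have "\<exists>y. y \<in> h \<and> y \<in> N"
    using cl pcD(3,5) unfolding in_closure_of by blast
  then show "h \<in> range ray" using half_edge_in_chart[OF h] by (metis rangeI)
next
  fix h assume "h \<in> range ray"
  then obtain j where j: "h = ray j" by blast
  have "v \<in> T closure_of ray j"
    unfolding in_closure_of using pcD(4,5) sector_near_vertex by (metis subsetD)
  then show "h \<in> half_edges_at X f v" using j ray(1) by (simp add: half_edges_at_def)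
qed

definition tangent_factor where "tangent_factor = sgn (inverse (g (\<phi> v)))"

lemma tangent_factor_nz: "tangent_factor \<noteq> 0"
  using g_nz[OF pcD(5)] by (simp add: tangent_factor_def sgn_zero_iff)

text \<open>
  On the ray, \<open>\<phi> x - \<phi> v = w x / g (\<phi> x)\<close>: the first factor has constant argument, and the second one
  converges. The change of coordinates thus rotates all directions by the same \<open>tangent_factor\<close>.
\<close>

lemma direction_ray: "direction X v (ray j) = cis (2 * pi * j / k) * tangent_factor"
proof -
  let ?F = "atin_within T v (ray j)"
  have vT: "v \<in> topspace T" using pcD(4,5) by blast
  have nb: "?F \<noteq> bot"
    unfolding derived_set_of_trivial_limit[symmetric] in_derived_set_of
    using vT sector_near_vertex by metis
  have inN: "eventually (\<lambda>x. x \<in> N \<and> x \<in> ray j) ?F"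
    unfolding eventually_atin_within using pcD(3,5) by blast
  have c: "(U, \<phi>) \<in> charts X" using chart_at_properties(1)[OF surface vT] chart by simp
  have "(\<phi> \<longlongrightarrow> \<phi> v) ?F"
  proof (rule topological_tendstoI)
    fix V assume V: "open V" "\<phi> v \<in> V"
    show "eventually (\<lambda>x. \<phi> x \<in> V) ?F"
      unfolding eventually_atin_within
      using chart_properties(5)[OF surface c V(1)] V(2) pcD(5) NU
      by (intro disjI2 exI[of _ "{x \<in> U. \<phi> x \<in> V}"]) auto
  qed
  then have "((\<lambda>x. g (\<phi> x)) \<longlongrightarrow> g (\<phi> v)) ?F"
    using g_cont isCont_tendsto_compose by blast
  then have "((\<lambda>x. cis (2 * pi * j / k) * sgn (inverse (g (\<phi> x)))) \<longlongrightarrow> cis (2 * pi * j / k) * tangent_factor) ?F"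
    unfolding tangent_factor_def using g_nz[OF pcD(5)] by (intro tendsto_intros) auto
  moreover have "eventually (\<lambda>x. cis (2 * pi * j / k) * sgn (inverse (g (\<phi> x))) = sgn (\<phi> x - \<phi> v)) ?F"
    using inN
  proof eventually_elim
    case (elim x)
    obtain i t where it: "ray j = ray i" "0 < t" "w x = root_branch k i (of_real t)"
      using half_edge_in_chart[OF ray(1)] elim by metis
    have "cis (2 * pi * i / k) = cis (2 * pi * j / k)"
    proof -
      let ?t = "\<rho> / 2"
      have t: "0 < ?t" "?t < \<rho>" using rho by auto
      have "sector j (of_real ?t) = sector i (of_real ?t)"
        using ray(2)[of "of_real ?t"] real_in_sector_domain[OF t] it(1) by metis
      then have "root_branch k j (of_real ?t) = root_branch k i (of_real ?t)"
        using sector_real(2)[OF t] by metis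
      then show ?thesis using sgn_root_branch[OF t(1)] by metis
    qed
    then have "sgn (w x) = cis (2 * pi * j / k)" using sgn_root_branch[OF it(2)] it(3) by simp
    moreover have "\<phi> x - \<phi> v = w x * inverse (g (\<phi> x))" using w_eq g_nz elim by simp
    ultimately show ?case by (simp add: sgn_mult)
  qed
  ultimately have "((\<lambda>x. sgn (\<phi> x - \<phi> v)) \<longlongrightarrow> cis (2 * pi * j / k) * tangent_factor) ?F"
    by (rule Lim_transform_eventually)
  then show ?thesis
    unfolding direction_def chart using tendsto_Lim[OF nb] by simp
qed

text \<open>
  Every half-edge at the vertex is \<open>ray (i + m)\<close> for some \<open>m\<close> between 1 and \<open>k\<close>, and lies at angle \<open>2 * pi * m / k\<close>
  from \<open>ray i\<close>; the least angle is attained for \<open>m = 1\<close> only.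
\<close>

lemma rotation_ray: "rotation X f (ray i) = ray (i + 1)"
proof -
  have at: "ray i \<in> half_edges_at X f v" for i using half_edges_at_vertex by blast
  have v: "black_end X f (ray i) = v"
    by (rule black_end(3)[OF ray(1) pcD(7) at])
  define A where "A = (\<lambda>h'. ccw_angle (direction X v (ray i)) (direction X v h'))"
  have A: "A (ray (i + m)) = 2 * pi * m / k" if "1 \<le> m" "m \<le> int k" for m
    unfolding A_def direction_ray by (rule ccw_angle_cis[OF pcD(1) that tangent_factor_nz])
  have A1: "A (ray (i + 1)) = 2 * pi / k" using A[of 1] pcD(1) by simp
  have all: "\<exists>m. 1 \<le> m \<and> m \<le> int k \<and> h = ray (i + m)" if h: "h \<in> half_edges_at X f v" for h
  proof -
    obtain j where j: "h = ray j" using h unfolding half_edges_at_vertex image_def by blast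
    \<comment> \<open>The representative of \<open>j - i\<close> modulo \<open>k\<close> in the range from 1 to \<open>k\<close>.\<close>
    define m where "m = (j - i - 1) mod int k + 1"
    have "j = i + m + ((j - i - 1) div int k) * int k"
      unfolding m_def using div_mult_mod_eq[of "j - i - 1" "int k"] by linarith
    then have "h = ray (i + m)"
      using ray_mod[of "i + m" "(j - i - 1) div int k"] j by simp
    moreover have "0 \<le> (j - i - 1) mod int k" "(j - i - 1) mod int k < int k"
      using pcD(1) by simp_all
    then have "1 \<le> m" "m \<le> int k" unfolding m_def by linarith+
    ultimately show ?thesis by blast
  qed
  have "arg_min_on A (half_edges_at X f v) = ray (i + 1)"
    unfolding arg_min_on_def arg_min_def
  proof (rule some_equality)
    have ge: "2 * pi / k \<le> A h" if h: "h \<in> half_edges_at X f v" for h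
    proof -
      obtain m where m: "1 \<le> m" "m \<le> int k" "h = ray (i + m)" using all[OF h] by blast
      then show ?thesis using A[OF m(1,2)] pcD(1) by (simp add: field_simps)
    qed
    then show "is_arg_min A (\<lambda>x. x \<in> half_edges_at X f v) (ray (i + 1))"
      unfolding is_arg_min_def using at A1 by (metis not_less)
    fix h assume "is_arg_min A (\<lambda>x. x \<in> half_edges_at X f v) h"
    then have "h \<in> half_edges_at X f v" "A h \<le> A (ray (i + 1))"
      unfolding is_arg_min_def not_less[symmetric] using at by blast+
    then have h: "h \<in> half_edges_at X f v" "A h \<le> 2 * pi / k" using A1 by simp_all
    obtain m where m: "1 \<le> m" "m \<le> int k" "h = ray (i + m)" using all[OF h(1)] by blast
    then have "real_of_int m \<le> 1" using A[OF m(1,2)] h(2) pcD(1) by (simp add: field_simps)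
    then have "m = 1" using m(1) by linarith
    then show "h = ray (i + 1)" using m(3) by simp
  qed
  then show ?thesis by (simp add: rotation_def v A_def)
qed

end

context dessin_map
begin

lemma black_vertex_chart_exists:
  assumes v: "v \<in> black_vertices X f"
  obtains U \<phi> k r N w w' g where "black_vertex_chart X f v U \<phi> k r N w w' g"
proof -
  have vT: "v \<in> topspace T" "f v = Some 0" using v by (auto simp: black_vertices_def)
  obtain U \<phi> where ch: "chart_at X v = (U, \<phi>)" by fastforce
  show ?thesis
  proof (rule power_chart_exists[OF vT ch zero_less_one])
    fix k r N w w' g
    assume *: "power_chart 0 v k r N w w'" "r \<le> 1" "N \<subseteq> U"
      "\<And>y. y \<in> N \<Longrightarrow> w y = (\<phi> y - \<phi> v) * g (\<phi> y)" "isCont g (\<phi> v)" "\<And>y. y \<in> N \<Longrightarrow> g (\<phi> y) \<noteq> 0"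
    have "black_vertex_chart X f v U \<phi> k r N w w' g"
      by unfold_locales (fact ch *)+
    then show thesis by (rule that)
  qed
qed

lemma section_on_subset: "section_on T f W s \<Longrightarrow> V \<subseteq> W \<Longrightarrow> section_on T f V s"
  by (auto simp: section_on_def intro: continuous_map_from_subtopology_mono)

lemma half_plane_section_unique:
  assumes s: "section_on T f {z. 0 < c * Im z} s" "section_on T f {z. 0 < c * Im z} s'"
    and z0: "0 < c * Im z0" "s z0 = s' z0" and z: "0 < c * Im z"
  shows "s z = s' z"
proof (rule cover.section_unique[OF s, of z0])
  have "{z. 0 < c * Im z} = {z. inner (c *\<^sub>R \<i>) z > 0}" by (auto simp: inner_complex_def)
  then show "connected {z. 0 < c * Im z}" by (metis convex_connected convex_halfspace_gt)
qed (use z0 z in auto)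

text \<open>
  Two half-edges follow each other around a black vertex as soon as the upper triangle at the first and the
  lower triangle at the second share the edge over the negative reals between them. Near the
  vertex the section \<open>c\<close> over this edge is a root of \<open>f\<close> cut along the positive reals, which passes from branch
  \<open>i\<close> in the upper half plane to branch \<open>i + 1\<close> in the lower one. The statement does not
  mention the vertex and can be read for the dual dessin as well.
\<close>

lemma rotation_via_gap_section:
  assumes h: "h \<in> half_edges X f" and h': "h' \<in> half_edges X f"
    and c: "section_on T f gap_domain c"
    and up: "c \<i> = edge_section h \<i>" and low: "c (- \<i>) = edge_section h' (- \<i>)"
  shows "rotation X f h = h'"
proof -
  obtain U \<phi> k r N w w' g where B: "black_vertex_chart X f (black_end X f h) U \<phi> k r N w w' g"
    using black_vertex_chart_exists[OF black_end(1)[OF h]] by blast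
  interpret B: black_vertex_chart X f "black_end X f h" U \<phi> k r N w w' g by (rule B)
  obtain i where i: "h = B.ray i"
    using black_end(2)[OF h] unfolding B.half_edges_at_vertex by blast
  let ?P = "\<lambda>a. {z. 0 < a * Im z}"
  have sub: "?P a \<subseteq> edge_domain" "?P a \<subseteq> gap_domain" for a
    by (auto simp: slit_domain_def)
  have c_up: "c z = edge_section h z" if "0 < Im z" for z
    using half_plane_section_unique[of 1 c "edge_section h" \<i> z] that up
      section_on_subset[OF c sub(2)[of 1]] section_on_subset[OF edge_section(1)[OF h] sub(1)[of 1]] by simp
  have c_low: "c z = edge_section h' z" if "Im z < 0" for z
    using half_plane_section_unique[of "-1" c "edge_section h'" "- \<i>" z] that low
      section_on_subset[OF c sub(2)[of "-1"]] section_on_subset[OF edge_section(1)[OF h'] sub(1)[of "-1"]] by simp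
  let ?G = "gap_domain \<inter> ball 0 B.\<rho>" and ?E = "edge_domain \<inter> ball 0 B.\<rho>"
  \<comment> \<open>A test value inside the power chart; it lies in the upper half plane, its negative in the lower one.\<close>
  let ?p = "\<i> * of_real (B.\<rho> / 2)"
  have p: "?p \<in> ?G" "?p \<in> ?E" "- ?p \<in> ?G" "- ?p \<in> ?E" "0 < Im ?p"
    using B.rho by (auto simp: slit_domain_def norm_mult)
  have "c ?p = w' (gap_root_branch k i ?p)"
    using c_up[OF p(5)] B.ray(2)[OF p(2), of i] i gap_root_branch_upper[OF p(5), of k i]
    by (simp add: B.sector_def)
  then have "c (- ?p) = w' (gap_root_branch k i (- ?p))"
  proof (rule cover.section_unique[OF section_on_subset[OF c] B.gap_sector_section _ _ p(1) _ p(3), rotated -1])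
    show "connected ?G"
      using B.rho by (intro connected_slit_domain_Int[of _ "- B.\<rho> / 2"]) auto
  qed (auto simp: slit_domain_def)
  also have "\<dots> = B.sector (i + 1) (- ?p)"
    using gap_root_branch_lower[of "- ?p" k i] p(5) by (simp add: B.sector_def)
  finally have "edge_section h' (- ?p) = B.sector (i + 1) (- ?p)"
    using c_low[of "- ?p"] p(5) by simp
  then have "h' = B.ray (i + 1)" by (rule B.ray_eqI[OF h' p(4)])
  then show ?thesis using i B.rotation_ray by simp
qed

text \<open>
  If \<open>ray (i + 1) = ray i\<close> then \<open>k = 1\<close>, and all rays coincide. A formal loop thus makes both the
  number of half-edges at its vertex and the ramification index there equal to 1; the latter is the degree of
  the corresponding face when the dessin is a dual.
\<close>

lemma rotation_fixed:
  assumes h: "h \<in> half_edges X f" and fixed: "rotation X f h = h"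
  shows "vertex_degree X f (black_end X f h) = 1"
    "ramification_index X riemann_sphere f (black_end X f h) = 1"
proof -
  obtain U \<phi> k r N w w' g where B: "black_vertex_chart X f (black_end X f h) U \<phi> k r N w w' g"
    using black_vertex_chart_exists[OF black_end(1)[OF h]] by blast
  interpret B: black_vertex_chart X f "black_end X f h" U \<phi> k r N w w' g by (rule B)
  obtain i where i: "h = B.ray i"
    using black_end(2)[OF h] unfolding B.half_edges_at_vertex by blast
  then have k: "k = 1" using fixed B.rotation_ray B.ray_inject_step by metis
  then show "ramification_index X riemann_sphere f (black_end X f h) = 1"
    using B.pcD(15) by simp
  have "B.ray j = B.ray 0" for j using B.ray_mod[of 0 j] k by simp
  then have "range B.ray = {B.ray 0}" by auto
  then show "vertex_degree X f (black_end X f h) = 1"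
    by (simp add: vertex_degree_def B.half_edges_at_vertex)
qed

text \<open>
  Since the dual takes the value \<open>1 / z\<close> where \<open>f\<close> takes \<open>z\<close>, sections are reparametrised by inversion, which exchanges
  the upper and the lower half plane.
\<close>

lemma dual_section:
  assumes s: "section_on T f W s" and V: "\<And>z. z \<in> V \<Longrightarrow> z \<noteq> 0 \<and> 1 / z \<in> W"
  shows "section_on T (dual_map f) V (\<lambda>z. s (1 / z))"
proof -
  have "continuous_map (top_of_set V) (top_of_set W) (\<lambda>z. 1 / z)"
    using V by (auto intro!: continuous_intros)
  then have "continuous_map (top_of_set V) T (s \<circ> (\<lambda>z. 1 / z))"
    using s unfolding section_on_def by (metis continuous_map_compose)
  moreover have "dual_map f (s (1 / z)) = Some z" if "z \<in> V" for z
    using V[OF that] section_onD(2)[OF s] by (simp add: dual_map_def sphere_inverse_def)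
  ultimately show ?thesis by (simp add: section_on_def comp_def)
qed

end

section \<open>The correspondence between the arrows of dual quivers\<close>

lemma dual_map_dual_map [simp]: "dual_map (dual_map f) = f"
  by (auto simp: dual_map_def)

lemma reciprocal_gap_domain: "z \<in> gap_domain \<Longrightarrow> z \<noteq> 0 \<and> 1 / z \<in> gap_domain"
  by (auto simp: slit_domain_def Re_divide Im_divide divide_less_0_iff sum_power2_gt_zero_iff)

text \<open>
  A locale of its own: as a property of every dessin, the interpretation of its dual would entail the
  interpretation of the dual of the dual, and so on without end.
\<close>

locale dual_pair = dessin_map
begin

sublocale dual: dessin_map X "dual_map f"
  using dual_dessin dessin_map_axioms dessin_map_iff by blast

text \<open>
  The sections of a half-edge of \<open>f\<close> and of a half-edge of the dual that border on the same triangle agree on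
  its whole half plane. Letting \<open>z\<close> tend to 1 inside this half plane gives the white end of either.
\<close>

lemma white_end_eq:
  assumes h: "h \<in> half_edges X f" and b: "b \<in> half_edges X (dual_map f)"
    and z0: "Im z0 \<noteq> 0" and eq: "edge_section h z0 = dual.edge_section b (1 / z0)"
  shows "white_end X f h = white_end X (dual_map f) b"
proof -
  define c where "c = Im z0"
  let ?P = "{z. 0 < c * Im z}"
  have z0P: "0 < c * Im z0" using z0 by (auto simp: c_def zero_less_mult_iff)
  have sub: "?P \<subseteq> edge_domain" by (auto simp: slit_domain_def)
  have rec: "z \<noteq> 0 \<and> 1 / z \<in> edge_domain" if "z \<in> ?P" for z
    using that by (auto simp: slit_domain_def Im_divide)
  have s1: "section_on T f ?P (edge_section h)"
    using section_on_subset[OF edge_section(1)[OF h] sub] .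
  have s2: "section_on T f ?P (\<lambda>z. dual.edge_section b (1 / z))"
    using dual.dual_section[OF dual.edge_section(1)[OF b], of ?P, OF rec] by simp
  have agree: "edge_section h z = dual.edge_section b (1 / z)" if "z \<in> ?P" for z
    using half_plane_section_unique[OF s1 s2 z0P eq] that by blast
  let ?F = "at 1 within ?P"
  have "limitin T (edge_section h) (white_end X f h) ?F"
    using white_end(2)[OF h] sub unfolding limitin_def
    by (metis (no_types, lifting) at_le filter_leD)
  moreover have "limitin T (\<lambda>z. dual.edge_section b (1 / z)) (white_end X (dual_map f) b) ?F"
    unfolding limitin_def
  proof (intro conjI allI impI)
    have lim: "limitin T (dual.edge_section b) (white_end X (dual_map f) b) (at 1 within edge_domain)"
      by (rule dual.white_end(2)[OF b])
    then show "white_end X (dual_map f) b \<in> topspace T" by (simp add: limitin_def)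
    fix V assume "openin T V \<and> white_end X (dual_map f) b \<in> V"
    then have ev: "eventually (\<lambda>z. dual.edge_section b z \<in> V) (at 1 within edge_domain)"
      using lim by (simp add: limitin_def)
    have "filterlim (\<lambda>z. 1 / z) (at 1 within edge_domain) ?F"
      unfolding filterlim_at
    proof
      have "((\<lambda>z::complex. 1 / z) \<longlongrightarrow> 1 / 1) ?F" by (intro tendsto_intros) auto
      then show "((\<lambda>z::complex. 1 / z) \<longlongrightarrow> 1) ?F" by simp
      show "eventually (\<lambda>z. 1 / z \<in> edge_domain \<and> 1 / z \<noteq> 1) ?F"
        using rec by (auto simp: eventually_at_filter slit_domain_def intro!: always_eventually)
    qed
    then show "eventually (\<lambda>z. dual.edge_section b (1 / z) \<in> V) ?F"
      by (rule eventually_compose_filterlim[OF ev])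
  qed
  then have "limitin T (edge_section h) (white_end X (dual_map f) b) ?F"
    by (rule limitin_transform_eventually[rotated])
       (use agree in \<open>auto simp: eventually_at_filter intro!: always_eventually\<close>)
  moreover have "?F \<noteq> bot"
  proof -
    have "1 \<in> closure ?P"
    proof (subst closure_approachable, intro allI impI)
      fix e :: real assume e: "0 < e"
      let ?z = "1 + \<i> * of_real (sgn c * (e / 2))"
      have c: "c \<noteq> 0" using z0 by (simp add: c_def)
      have "0 < c * Im ?z" using c e by (auto simp: sgn_if zero_less_mult_iff)
      moreover have "dist ?z 1 < e" using c e by (simp add: dist_norm norm_mult abs_mult abs_sgn_eq)
      ultimately show "\<exists>z\<in>?P. dist z 1 < e" by blast
    qed
    moreover have "1 \<notin> ?P" by simp
    ultimately show ?thesis by (simp add: at_within_eq_bot_iff)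
  qed
  ultimately show ?thesis using limitin_Hausdorff_unique[OF _ _ _ Hausdorff] by metis
qed

text \<open>
  The bijection between the arrows of the two quivers. The section \<open>c\<close> runs over the negative reals, through an edge
  that joins a black vertex to a face centre. On its upper side lies the upper triangle of \<open>h\<close>, on its lower side
  a triangle whose side over the reals above 1 is \<open>b\<close>. Inversion turns the value \<open>- \<i>\<close> of \<open>f\<close> into
  the value \<open>\<i>\<close> of the dual.
\<close>

definition crosses :: "'a set \<Rightarrow> 'a set \<Rightarrow> bool" where
  "crosses h b \<longleftrightarrow> h \<in> half_edges X f \<and> b \<in> half_edges X (dual_map f) \<and>
     (\<exists>c. section_on T f gap_domain c \<and> c \<i> = edge_section h \<i> \<and> c (- \<i>) = dual.edge_section b \<i>)"

lemma gap_section_exists: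
  assumes "x \<in> topspace T" "f x = Some z" "z \<in> gap_domain"
  obtains c where "section_on T f gap_domain c" "c z = x"
  using slit_section_exists[OF _ _ _ _ _ assms] by auto

lemma gap_section_unique:
  assumes "section_on T f gap_domain c" "section_on T f gap_domain c'"
    "z0 \<in> gap_domain" "c z0 = c' z0" "z \<in> gap_domain"
  shows "c z = c' z"
  by (rule slit_section_unique[OF assms(1,2) refl _ _ _ _ assms(3-5)]) auto

lemma imaginary_units:
  "\<i> \<in> edge_domain" "- \<i> \<in> edge_domain" "\<i> \<in> gap_domain" "- \<i> \<in> gap_domain"
  by (auto simp: slit_domain_def)

lemma crosses_exists_right:
  assumes h: "h \<in> half_edges X f"
  shows "\<exists>b. crosses h b"
proof -
  note I = imaginary_units
  obtain c where c: "section_on T f gap_domain c" "c \<i> = edge_section h \<i>"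
    using gap_section_exists[OF section_onD[OF edge_section(1)[OF h] I(1)] I(3)] by blast
  have x: "c (- \<i>) \<in> topspace T" "f (c (- \<i>)) = Some (- \<i>)" using section_onD[OF c(1) I(4)] .
  then have "dual_map f (c (- \<i>)) = Some \<i>" by (simp add: dual_map_def sphere_inverse_def divide_minus_right)
  then obtain b where "b \<in> half_edges X (dual_map f)" "dual.edge_section b \<i> = c (- \<i>)"
    using dual.half_edge_through[OF x(1) _ I(1)] by blast
  then show ?thesis using h c unfolding crosses_def by metis
qed

lemma crosses_exists_left:
  assumes b: "b \<in> half_edges X (dual_map f)"
  shows "\<exists>h. crosses h b"
proof -
  note I = imaginary_units
  have x: "dual.edge_section b \<i> \<in> topspace T" "dual_map f (dual.edge_section b \<i>) = Some \<i>"
    using dual.section_onD[OF dual.edge_section(1)[OF b] I(1)] .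
  have "f (dual.edge_section b \<i>) = sphere_inverse (dual_map f (dual.edge_section b \<i>))"
    by (simp add: dual_map_def)
  then have "f (dual.edge_section b \<i>) = Some (- \<i>)"
    unfolding x(2) by (simp add: sphere_inverse_def)
  then obtain c where c: "section_on T f gap_domain c" "c (- \<i>) = dual.edge_section b \<i>"
    using gap_section_exists[OF x(1) _ I(4)] by auto
  obtain h where "h \<in> half_edges X f" "edge_section h \<i> = c \<i>"
    using half_edge_through[OF section_onD[OF c(1) I(3)] I(1)] by blast
  then show ?thesis using b c unfolding crosses_def by metis
qed

lemma crosses_agree:
  assumes "crosses h b" "crosses h' b'"
  shows "edge_section h \<i> = edge_section h' \<i> \<longleftrightarrow> dual.edge_section b \<i> = dual.edge_section b' \<i>"
proof -
  note I = imaginary_units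
  obtain c c' where c: "section_on T f gap_domain c" "c \<i> = edge_section h \<i>" "c (- \<i>) = dual.edge_section b \<i>"
    and c': "section_on T f gap_domain c'" "c' \<i> = edge_section h' \<i>" "c' (- \<i>) = dual.edge_section b' \<i>"
    using assms unfolding crosses_def by blast
  have "c \<i> = c' \<i> \<longleftrightarrow> c (- \<i>) = c' (- \<i>)"
    using gap_section_unique[OF c(1) c'(1) I(3) _ I(4)] gap_section_unique[OF c(1) c'(1) I(4) _ I(3)] by blast
  then show ?thesis unfolding c(2,3) c'(2,3) .
qed

lemma crosses_inject:
  assumes C: "crosses h b" "crosses h' b'"
  shows "h = h' \<longleftrightarrow> b = b'"
proof -
  note H = C[unfolded crosses_def, THEN conjunct1] and B = C[unfolded crosses_def, THEN conjunct2, THEN conjunct1]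
  have "h = h' \<longleftrightarrow> edge_section h \<i> = edge_section h' \<i>"
    using edge_section_inject[OF H imaginary_units(1)] by blast
  also have "\<dots> \<longleftrightarrow> dual.edge_section b \<i> = dual.edge_section b' \<i>"
    by (rule crosses_agree[OF C])
  also have "\<dots> \<longleftrightarrow> b = b'"
    using dual.edge_section_inject[OF B imaginary_units(1)] by blast
  finally show ?thesis .
qed

text \<open>
  The same edge over the negative reals is crossed by the rotation of \<open>f\<close> at its black end, from \<open>h\<close> to the half-edge
  \<open>h'\<close> in the lower triangle, and by the rotation of the dual at its face centre, from \<open>b\<close> to the half-edge \<open>b'\<close>
  in the upper triangle. As \<open>h\<close> and \<open>b'\<close> share the upper triangle, and \<open>h'\<close> and \<open>b\<close> the lower
  one, they have the same white ends; the direction of the arrow is reversed.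
\<close>

lemma crosses_white_ends:
  assumes hb: "crosses h b"
  shows "white_end X (dual_map f) b = white_end X f (rotation X f h)"
    "white_end X (dual_map f) (rotation X (dual_map f) b) = white_end X f h"
proof -
  note I = imaginary_units
  obtain c where h: "h \<in> half_edges X f" and b: "b \<in> half_edges X (dual_map f)"
    and c: "section_on T f gap_domain c" "c \<i> = edge_section h \<i>" "c (- \<i>) = dual.edge_section b \<i>"
    using hb unfolding crosses_def by blast
  obtain h' where h': "h' \<in> half_edges X f" "edge_section h' (- \<i>) = c (- \<i>)"
    using half_edge_through[OF section_onD[OF c(1) I(4)] I(2)] by blast
  have "rotation X f h = h'"
    using rotation_via_gap_section[OF h h'(1) c(1,2)] h'(2) by simp
  moreover have "white_end X f h' = white_end X (dual_map f) b"
    using white_end_eq[OF h'(1) b, of "- \<i>"] h'(2) c(3) by simp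
  ultimately show "white_end X (dual_map f) b = white_end X f (rotation X f h)" by simp
  let ?d = "\<lambda>z. c (1 / z)"
  have d: "section_on T (dual_map f) gap_domain ?d"
    using dual_section[OF c(1) reciprocal_gap_domain] by blast
  obtain b' where b': "b' \<in> half_edges X (dual_map f)" "dual.edge_section b' (- \<i>) = ?d (- \<i>)"
    using dual.half_edge_through[OF dual.section_onD[OF d I(4)] I(2)] by blast
  have "rotation X (dual_map f) b = b'"
    using dual.rotation_via_gap_section[OF b b'(1) d] b'(2) c(3) by simp
  moreover have "white_end X f h = white_end X (dual_map f) b'"
    using white_end_eq[OF h b'(1), of \<i>] b'(2) c(2) by simp
  ultimately show "white_end X (dual_map f) (rotation X (dual_map f) b) = white_end X f h" by simp
qed

lemma full_quiver_eq: "quiver_eq (full_quiver X f) (op_quiver (full_quiver X (dual_map f)))"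
proof -
  define \<beta> where "\<beta> h = (SOME b. crosses h b)" for h
  have \<beta>: "crosses h (\<beta> h)" if "h \<in> half_edges X f" for h
    unfolding \<beta>_def using someI_ex[OF crosses_exists_right[OF that]] .
  have "bij_betw \<beta> (half_edges X f) (half_edges X (dual_map f))"
  proof (rule bij_betwI')
    show "(\<beta> h = \<beta> h') = (h = h')" if "h \<in> half_edges X f" "h' \<in> half_edges X f" for h h'
      using crosses_inject[OF \<beta>[OF that(1)] \<beta>[OF that(2)]] by simp
    show "\<beta> h \<in> half_edges X (dual_map f)" if "h \<in> half_edges X f" for h
      using \<beta>[OF that] by (simp add: crosses_def)
    show "\<exists>h\<in>half_edges X f. b = \<beta> h" if b: "b \<in> half_edges X (dual_map f)" for b
    proof -
      obtain h where hb: "crosses h b" using crosses_exists_left[OF b] by blast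
      then have h: "h \<in> half_edges X f" by (simp add: crosses_def)
      then have "b = \<beta> h" using crosses_inject[OF hb \<beta>[OF h]] by simp
      then show ?thesis using h by blast
    qed
  qed
  moreover have "white_vertices X f = white_vertices X (dual_map f)"
    by (auto simp: white_vertices_def dual_map_def sphere_inverse_def split: option.splits if_splits)
  ultimately show ?thesis
    unfolding quiver_eq_def op_quiver_def full_quiver_def
    using crosses_white_ends[OF \<beta>] by (auto intro!: exI[of _ \<beta>])
qed

lemma no_formal_loops:
  assumes "\<And>v. v \<in> black_vertices X f \<Longrightarrow> vertex_degree X f v \<noteq> 1"
  shows "formal_loops X f = {}"
  using assms rotation_fixed(1) black_end(1) by (auto simp: formal_loops_def)

lemma no_dual_formal_loops:
  assumes deg: "\<And>c. c \<in> face_centres X f \<Longrightarrow> face_degree X f c \<noteq> 1"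
  shows "formal_loops X (dual_map f) = {}"
proof -
  have "rotation X (dual_map f) h \<noteq> h" if h: "h \<in> half_edges X (dual_map f)" for h
  proof
    assume fixed: "rotation X (dual_map f) h = h"
    let ?c = "black_end X (dual_map f) h"
    have c: "?c \<in> topspace T" "f ?c = None"
      using dual.black_end(1)[OF h]
      by (auto simp: black_vertices_def dual_map_def sphere_inverse_def split: option.splits if_splits)
    then have "face_degree X f ?c = 1"
      using dual.rotation_fixed(2)[OF h fixed] ramification_index_dual_map[of ?c]
      by (simp add: face_degree_def)
    then show False using deg c by (simp add: face_centres_def)
  qed
  then show ?thesis by (auto simp: formal_loops_def)
qed

end

theorem theorem6p3:
  fixes X :: "'a surface" and f :: "'a \<Rightarrow> complex option"
  assumes "dessin X f"
  shows "quiver_eq (full_quiver X f) (op_quiver (full_quiver X (dual_map f))) \<and>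
    ((\<forall>v \<in> black_vertices X f \<union> white_vertices X f. vertex_degree X f v \<noteq> 1) \<and>
     (\<forall>c \<in> face_centres X f. face_degree X f c \<noteq> 1) \<longrightarrow>
     quiver_eq (dessin_quiver X f) (op_quiver (dessin_quiver X (dual_map f))))"
proof -
  interpret dual_pair X f
    using assms by (simp add: dual_pair_def dessin_map_iff)
  have "quiver_eq (dessin_quiver X f) (op_quiver (dessin_quiver X (dual_map f)))"
    if "\<forall>v \<in> black_vertices X f \<union> white_vertices X f. vertex_degree X f v \<noteq> 1"
      "\<forall>c \<in> face_centres X f. face_degree X f c \<noteq> 1"
  proof -
    have "dessin_quiver X f = full_quiver X f" "dessin_quiver X (dual_map f) = full_quiver X (dual_map f)"
      using no_formal_loops no_dual_formal_loops that by (simp_all add: dessin_quiver_def)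
    then show ?thesis using full_quiver_eq by simp
  qed
  then show ?thesis using full_quiver_eq by blast
qed

end
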